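(* Let $d\ge 5$ be an integer, let $p>\frac{2d}{d-4}$, and let $c>0$. Then there is a constant $C=C(d,p,c)$ such that for all $N\ge 1$, all $\delta$ with $cN^{-1}\le\delta\le 1$, and all $f\in L^2(\mathbb{T}^d)$, $$\|P_{N,\delta}f\|_{L^p(\mathbb{T}^d)}\le C\,N^{\frac{d-1}{2}-\frac{d}{p}}\,\delta^{1/2}\,\|f\|_{L^2(\mathbb{T}^d)}.$$
   Context: $\mathbb{T}^d=\mathbb{R}^d/\mathbb{Z}^d$ is the square torus, identified with $[0,1]^d$ with Lebesgue measure. For $f\in L^2(\mathbb{T}^d)$ and $\mathbf{k}\in\mathbb{Z}^d$, $\mathcal{F}(f)(\mathbf{k})=\int_{\mathbb{T}^d}e^{-2\pi i\mathbf{k}\cdot x}f(x)\,dx$. The spectral projector is $$P_{N,\delta}f(x)=\sum_{\mathbf{k}\in\mathbb{Z}^d\cap A_{N,\delta}}\mathcal{F}(f)(\mathbf{k})\,e^{2\pi i\mathbf{k}\cdot x},$$ where $A_{N,\delta}=\{\xi\in\mathbb{R}^d:\ \bigl||\xi|-N\bigr|\le\delta/2\}$ is the annulus of radius $N$ and width $\delta$. *)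

theory Defs
  imports "HOL-Analysis.Analysis" "HOL-Probability.Essential_Supremum"
begin

text \<open>
  The dimension is \<open>d = CARD('n)\<close>. The torus is the unit cube with Lebesgue measure, and
  functions on it are functions on the whole space whose values off the cube are never used.
\<close>

definition torus :: "(real ^ 'n) measure"
  where "torus = lebesgue_on (cbox 0 1)"

text \<open>
  The exponent ranges over \<open>(0, \<infinity>]\<close>. Norms take values in \<^typ>\<open>ennreal\<close>, so that
  a non-integrable power gives \<open>\<infinity>\<close> and not \<open>0\<close>; there is no \<open>powr\<close> on
  \<^typ>\<open>ennreal\<close>, hence the case distinction.
\<close>

definition Lp_norm :: "'a measure \<Rightarrow> ennreal \<Rightarrow> ('a \<Rightarrow> complex) \<Rightarrow> ennreal"
  where "Lp_norm M p f =
    (if p = \<infinity> then esssup M (\<lambda>x. ennreal (norm (f x)))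
     else let I = (\<integral>\<^sup>+ x. ennreal (norm (f x) powr enn2real p) \<partial>M)
          in if I = \<infinity> then \<infinity> else ennreal (enn2real I powr (1 / enn2real p)))"

definition Lp_space :: "'a measure \<Rightarrow> ennreal \<Rightarrow> ('a \<Rightarrow> complex) set"
  where "Lp_space M p = {f \<in> borel_measurable M. Lp_norm M p f < \<infinity>}"

definition int_lattice :: "(real ^ 'n) set"
  where "int_lattice = {k. \<forall>i. k $ i \<in> \<int>}"

definition annulus :: "real \<Rightarrow> real \<Rightarrow> (real ^ 'n) set"
  where "annulus N \<delta> = {\<xi>. \<bar>norm \<xi> - N\<bar> \<le> \<delta> / 2}"

definition fourier_char :: "real ^ 'n \<Rightarrow> real ^ 'n \<Rightarrow> complex"
  where "fourier_char k x = exp (2 * of_real pi * \<i> * of_real (k \<bullet> x))"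

definition fourier_coeff :: "(real ^ 'n \<Rightarrow> complex) \<Rightarrow> real ^ 'n \<Rightarrow> complex"
  where "fourier_coeff f k = (LINT x|torus. fourier_char (- k) x * f x)"

definition spectral_projector ::
    "real \<Rightarrow> real \<Rightarrow> (real ^ 'n \<Rightarrow> complex) \<Rightarrow> real ^ 'n \<Rightarrow> complex"
  where "spectral_projector N \<delta> f x =
    (\<Sum>k \<in> int_lattice \<inter> annulus N \<delta>. fourier_coeff f k * fourier_char k x)"

text \<open>The sum defining the projector is over a finite set, so it never takes the default value.\<close>

lemma finite_int_lattice_annulus:
  "finite (int_lattice \<inter> annulus N \<delta> :: (real ^ 'n) set)"
proof -
  define R where "R = \<lceil>N + \<delta> / 2\<rceil>"
  have "int_lattice \<inter> annulus N \<delta> \<subseteq>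
      (\<lambda>g. \<chi> i. real_of_int (g i)) ` (Pi\<^sub>E (UNIV :: 'n set) (\<lambda>_. {-R..R}))"
  proof
    fix k :: "real ^ 'n" assume k: "k \<in> int_lattice \<inter> annulus N \<delta>"
    then have "k $ i \<in> \<int>" for i by (simp add: int_lattice_def)
    then have eq: "real_of_int \<lfloor>k $ i\<rfloor> = k $ i" for i by (simp add: of_int_floor_cancel)
    have "\<bar>norm k - N\<bar> \<le> \<delta> / 2" using k by (simp add: annulus_def)
    then have "norm k \<le> N + \<delta> / 2" by linarith
    then have "\<bar>k $ i\<bar> \<le> of_int R" for i
      using component_le_norm_cart[of k i] unfolding R_def by linarith
    then have "of_int (- R) \<le> k $ i" "k $ i \<le> of_int R" for i by (simp_all add: abs_le_iff minus_le_iff)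
    then have "\<lfloor>k $ i\<rfloor> \<in> {-R..R}" for i
      by (metis atLeastAtMost_iff eq of_int_le_iff)
    then show "k \<in> (\<lambda>g. \<chi> i. real_of_int (g i)) ` (Pi\<^sub>E (UNIV :: 'n set) (\<lambda>_. {-R..R}))"
      by (intro image_eqI[of _ _ "\<lambda>i. \<lfloor>k $ i\<rfloor>"]) (auto simp: vec_eq_iff eq PiE_def Pi_def)
  qed
  then show ?thesis by (rule finite_subset) (intro finite_imageI finite_PiE, auto)
qed

end

theory Submission
  imports Defs
begin

text \<open>
  Write \<open>d\<close> for the dimension, \<open>\<mu>\<close> for Lebesgue measure on the torus and \<open>F\<close> for the projected function,
  whose Fourier coefficients have square sum at most \<open>A\<^sup>2\<close> by Bessel's inequality. For the level set
  \<open>E = {|F| > \<alpha>}\<close> put \<open>g = sgn F\<close> on \<open>E\<close> and \<open>g = 0\<close> elsewhere. Pairing \<open>F\<close> with \<open>g\<close> shows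
  that \<open>\<alpha>\<^sup>2 \<mu>(E)\<^sup>2\<close> is at most \<open>A\<^sup>2\<close> times the energy of \<open>g\<close> at the frequencies in the annulus.

  A lattice point \<open>k\<close> is in the annulus if and only if the integer \<open>|k|\<^sup>2\<close> is in an interval that contains
  \<open>O(N\<delta>)\<close> integers. Detecting this by an integral over \<open>t \<in> [0, 1]\<close> against a Dirichlet kernel bounds the
  energy by \<open>O(N\<delta>)\<close> times the integral over \<open>t\<close> of \<open>|\<langle>T\<^sub>t g, g\<rangle>|\<close>, where \<open>T\<^sub>t\<close> is the periodic
  Schroedinger propagator cut off to a box of frequencies (\<open>sum_restricted_le_nn_integral\<close>). As \<open>T\<^sub>t\<close> has
  norm at most \<open>1\<close> on \<open>L\<^sup>2\<close> and a kernel bounded by some \<open>W(t)\<close>, and as \<open>|g|\<close> is at most the indicator of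
  \<open>E\<close>, the form is at most both \<open>\<mu>(E)\<close> and \<open>W(t) \<mu>(E)\<^sup>2\<close>, and so at most \<open>W(t)\<^bsup>\<theta>\<^esup> \<mu>(E)\<^bsup>1 + \<theta>\<^esup>\<close> for
  \<open>0 < \<theta> \<le> 1\<close>.

  The kernel is a product of \<open>d\<close> quadratic Weyl sums. Weyl differencing bounds the square of each of them by
  a constant times the sum \<open>G(t)\<close> of \<open>min H (1 / \<parallel>ht\<parallel>)\<close> over \<open>1 \<le> h \<le> H\<close>, with \<open>H\<close> comparable to \<open>N\<close> and \<open>\<parallel>x\<parallel>\<close> the
  distance to the nearest integer (\<open>norm_quadratic_sum_le\<close>). So \<open>W\<^bsup>\<theta>\<^esup> = O(G\<^bsup>\<sigma>\<^esup>)\<close> with \<open>\<sigma> = d\<theta>/2\<close>.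
  Dirichlet approximation shows that \<open>G\<close> is \<open>O(H log H)\<close> away from peaks of height \<open>H\<^sup>2/q\<close> and width
  \<open>H\<^bsup>-2\<^esup>\<close> at the fractions \<open>a/q\<close>, and integration gives \<open>O(H\<^bsup>2\<sigma> - 2\<^esup>)\<close> for the integral of \<open>G\<^bsup>\<sigma>\<^esup>\<close> when
  \<open>\<sigma> > 2\<close> (\<open>spike_sum_moment_le\<close>), with no logarithmic loss.

  Together, \<open>\<alpha>\<^sup>2 \<mu>(E)\<^bsup>1 - \<theta>\<^esup> = O(A\<^sup>2 \<delta> N\<^bsup>d\<theta> - 1\<^esup>)\<close> whenever \<open>d\<theta> > 4\<close> (\<open>level_set_bound\<close>). With
  \<open>\<theta> = 1 - 2/p\<close> the condition reads \<open>p > 2d/(d - 4)\<close>, and the bound is the theorem in weak type form.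
  The case \<open>\<theta> = 1\<close>, admissible because \<open>d \<ge> 5\<close>, is the bound for \<open>p = \<infinity>\<close>. Interpolating it with the weak bound for a
  slightly smaller \<open>p\<close> gives the strong bound (\<open>weak_type_imp_strong_type\<close>).
\<close>

section \<open>Quadratic exponential sums and Weyl differencing\<close>

definition phase :: "real \<Rightarrow> complex"
  where "phase x = cis (2 * pi * x)"

lemma phase_0 [simp]: "phase 0 = 1"
  by (simp add: phase_def)

lemma phase_add: "phase (x + y) = phase x * phase y"
  by (simp add: phase_def cis_mult ring_distribs)

lemma phase_of_int [simp]: "phase (of_int n) = 1"
  by (simp add: phase_def cis_conv_exp exp_eq_1 mult_ac)

lemma norm_phase [simp]: "norm (phase x) = 1"
  by (simp add: phase_def)

lemma cnj_phase: "cnj (phase x) = phase (- x)"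
  by (simp add: phase_def cis_cnj)

lemma continuous_on_phase [continuous_intros]:
  "continuous_on S f \<Longrightarrow> continuous_on S (\<lambda>x. phase (f x))"
  unfolding phase_def cis_conv_exp by (intro continuous_intros)

definition int_dist :: "real \<Rightarrow> real"
  where "int_dist x = \<bar>x - of_int (round x)\<bar>"

lemma int_dist_nonneg [simp]: "int_dist x \<ge> 0"
  by (simp add: int_dist_def)

lemma int_dist_le: "int_dist x \<le> \<bar>x - of_int n\<bar>"
  unfolding int_dist_def by (rule round_diff_minimal)

lemma int_dist_le_half: "int_dist x \<le> 1 / 2"
  using of_int_round_abs_le[of x] by (simp add: int_dist_def abs_minus_commute)

lemma int_dist_eq:
  assumes "\<bar>x - of_int n\<bar> < 1 / 2"
  shows "int_dist x = \<bar>x - of_int n\<bar>"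
  using round_unique'[OF assms] by (simp add: int_dist_def)

lemma int_dist_ge_minus: "int_dist x - \<bar>y\<bar> \<le> int_dist (x + y)"
proof -
  have "int_dist x \<le> \<bar>x - of_int (round (x + y))\<bar>"
    by (rule int_dist_le)
  then show ?thesis
    by (simp add: int_dist_def)
qed

lemma borel_measurable_int_dist [measurable]: "int_dist \<in> borel_measurable borel"
  unfolding int_dist_def[abs_def] round_def by measurable

lemma norm_cis_minus_1: "norm (cis y - 1) = 2 * \<bar>sin (y / 2)\<bar>"
proof -
  have "(norm (cis y - 1))\<^sup>2 = (cos y - 1)\<^sup>2 + (sin y)\<^sup>2"
    by (simp add: cmod_power2)
  also have "\<dots> = 2 - 2 * cos y"
    using sin_cos_squared_add[of y] by (simp add: power2_eq_square algebra_simps)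
  also have "\<dots> = (2 * \<bar>sin (y / 2)\<bar>)\<^sup>2"
    using cos_double_sin[of "y / 2"] by (simp add: power_mult_distrib)
  finally show ?thesis
    by (rule power2_eq_imp_eq) auto
qed

text \<open>
  The constant is far from the optimal \<open>2 / \<pi>\<close>, but it follows from the cubic Taylor bound and
  \<open>3 < \<pi> < 4\<close> alone.
\<close>

lemma abs_sin_ge:
  assumes "\<bar>u\<bar> \<le> pi / 2"
  shows "\<bar>u\<bar> / pi \<le> \<bar>sin u\<bar>"
proof -
  have "\<bar>sin u - (\<Sum>m<3. sin_coeff m * u ^ m)\<bar> \<le> inverse (fact 3) * \<bar>u\<bar> ^ 3"
    by (rule Maclaurin_sin_bound)
  then have "\<bar>sin u - u\<bar> \<le> \<bar>u\<bar> ^ 3 / 6"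
    by (simp add: sin_coeff_def eval_nat_numeral fact_numeral)
  then have 1: "\<bar>u\<bar> - \<bar>u\<bar> * u\<^sup>2 / 6 \<le> \<bar>sin u\<bar>"
    unfolding power2_eq_square power3_eq_cube abs_mult abs_mult_self_eq mult.assoc by linarith
  have "\<bar>u\<bar> \<le> 2"
    using assms pi_less_4 by linarith
  then have "\<bar>u\<bar>\<^sup>2 \<le> 2\<^sup>2"
    by (rule power_mono) simp
  then have "\<bar>u\<bar> * u\<^sup>2 \<le> \<bar>u\<bar> * 4"
    by (intro mult_left_mono) auto
  then have 2: "\<bar>u\<bar> / 3 \<le> \<bar>sin u\<bar>"
    using 1 by linarith
  have "\<bar>u\<bar> / pi \<le> \<bar>u\<bar> / 3"
    using pi_gt3 by (intro divide_left_mono) auto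
  then show ?thesis using 2 by linarith
qed

lemma norm_phase_minus_1_ge: "2 * int_dist x \<le> norm (phase x - 1)"
proof -
  define b where "b = x - of_int (round x)"
  have b: "\<bar>b\<bar> \<le> 1 / 2" "int_dist x = \<bar>b\<bar>"
    using int_dist_le_half[of x] by (auto simp: int_dist_def b_def)
  have "phase x = phase (of_int (round x) + b)"
    by (simp add: b_def)
  also have "\<dots> = phase b"
    by (simp only: phase_add phase_of_int mult_1)
  finally have "norm (phase x - 1) = 2 * \<bar>sin (pi * b)\<bar>"
    by (simp add: phase_def norm_cis_minus_1)
  moreover have "\<bar>pi * b\<bar> / pi \<le> \<bar>sin (pi * b)\<bar>"
    using mult_left_mono[OF b(1), of pi] by (intro abs_sin_ge) (simp add: abs_mult)
  ultimately show ?thesis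
    using b by (simp add: abs_mult)
qed

lemma phase_sum_telescope:
  "(\<Sum>l\<in>{a..<a + int n}. phase (of_int l * x)) * (phase x - 1)
     = phase (of_int (a + int n) * x) - phase (of_int a * x)"
proof (induction n)
  case 0
  then show ?case by simp
next
  case (Suc n)
  have "{a..<a + int (Suc n)} = insert (a + int n) {a..<a + int n}" by auto
  then show ?case
    using Suc by (simp add: algebra_simps phase_add)
qed

text \<open>
  This is \<open>min H (1 / \<parallel>x\<parallel>)\<close> with \<open>\<parallel>x\<parallel>\<close> the distance to the nearest integer, the standard majorant of
  a geometric sum of length \<open>H\<close>. In this form it has the correct value \<open>H\<close> also where
  \<open>\<parallel>x\<parallel> = 0\<close>, where the division would give \<open>0\<close>.
\<close>

definition spike :: "real \<Rightarrow> real \<Rightarrow> real"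
  where "spike H x = H / max 1 (H * int_dist x)"

lemma spike_nonneg [simp]: "0 \<le> H \<Longrightarrow> 0 \<le> spike H x"
  by (simp add: spike_def)

lemma spike_le: "0 \<le> H \<Longrightarrow> spike H x \<le> H"
  using mult_left_mono[of 1 "max 1 (H * int_dist x)" H]
  by (simp add: spike_def divide_le_eq less_max_iff_disj)

lemma spike_le_inverse: "0 < H \<Longrightarrow> 0 < int_dist x \<Longrightarrow> spike H x \<le> 1 / int_dist x"
  unfolding spike_def by (simp add: field_simps)

lemma spike_mono:
  assumes "0 \<le> H" "H \<le> K"
  shows "spike H x \<le> spike K x"
proof -
  have "H * int_dist x \<le> K * int_dist x"
    using assms by (intro mult_right_mono) auto
  then show ?thesis
    using assms unfolding spike_def
    by (cases "H = 0") (auto simp: field_simps max_def mult_left_mono)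
qed

lemma one_le_spike:
  assumes "1 \<le> H"
  shows "1 \<le> spike H x"
proof -
  have "H * int_dist x \<le> H"
    using int_dist_le_half[of x] assms by (simp add: mult_left_le)
  then show ?thesis
    using assms by (simp add: spike_def)
qed

lemma norm_phase_sum_le:
  assumes "b - a < int L" "0 < L"
  shows "norm (\<Sum>l\<in>{a..b}. phase (of_int l * x)) \<le> spike (real L) x"
proof -
  define n where "n = nat (b - a + 1)"
  define S where "S = (\<Sum>l\<in>{a..b}. phase (of_int l * x))"
  have n: "n \<le> L" using assms by (simp add: n_def)
  have I: "{a..b} = {a..<a + int n}" by (auto simp: n_def)
  have "norm S \<le> (\<Sum>l\<in>{a..b}. norm (phase (of_int l * x)))"
    unfolding S_def by (rule norm_sum)
  also have "\<dots> = real n" by (simp add: n_def)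
  finally have 1: "norm S \<le> real L" using n by simp
  have "norm S * (2 * int_dist x) \<le> norm S * norm (phase x - 1)"
    by (intro mult_left_mono norm_phase_minus_1_ge) simp
  also have "\<dots> = norm (phase (of_int (a + int n) * x) - phase (of_int a * x))"
    unfolding S_def I by (simp only: norm_mult[symmetric] phase_sum_telescope)
  also have "\<dots> \<le> 2"
    by (rule order_trans[OF norm_triangle_ineq4]) simp
  finally have 2: "norm S * int_dist x \<le> 1" by simp
  have "norm S * max 1 (real L * int_dist x) \<le> real L"
    using 1 mult_left_mono[OF 2, of "real L"] by (simp add: max_def mult_ac)
  then show ?thesis
    unfolding S_def spike_def by (simp add: pos_le_divide_eq)
qed

definition spike_sum :: "nat \<Rightarrow> real \<Rightarrow> real"
  where "spike_sum H t = (\<Sum>h=1..H. spike (real H) (real h * t))"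

lemma spike_sum_nonneg [simp]: "0 \<le> spike_sum H t"
  by (simp add: spike_sum_def sum_nonneg)

lemma le_spike_sum: "real H \<le> spike_sum H t"
proof -
  have "(\<Sum>h=1..H. 1) \<le> spike_sum H t"
    unfolding spike_sum_def by (intro sum_mono one_le_spike) auto
  then show ?thesis by simp
qed

lemma borel_measurable_spike_sum [measurable]: "spike_sum H \<in> borel_measurable borel"
  unfolding spike_sum_def[abs_def] spike_def by measurable

lemma int_dist_minus [simp]: "int_dist (- x) = int_dist x"
proof -
  have "int_dist (- x) \<le> int_dist x" for x
    using int_dist_le[of "- x" "- round x"] by (simp add: int_dist_def)
  from this[of x] this[of "- x"] show ?thesis by simp
qed

text \<open>
  Weyl differencing: in \<open>|S|\<^sup>2\<close> the pairs with a given difference \<open>h = j - l\<close> contribute a phase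
  times a geometric sum in \<open>l\<close> of ratio \<open>phase (2ht)\<close>. The shift \<open>z\<close> only enters the phase and has
  disappeared from the bound, which is what makes it a bound for the supremum of a kernel.
  Admitting odd multiples of \<open>t\<close> as well only enlarges the sum and removes the factor \<open>2\<close> from
  \<open>2ht\<close>, at the price of doubling the range of \<open>h\<close>.
\<close>

lemma norm_quadratic_sum_le:
  fixes R :: nat
  shows "(norm (\<Sum>j\<in>{- int R..int R}. phase (of_int (j * j) * t + of_int j * z)))\<^sup>2
           \<le> 3 * spike_sum (4 * R + 2) t"
proof -
  define L where "L = 2 * R + 1"
  define J where "J = {- int R..int R}"
  define T where "T = {- 2 * int R..2 * int R}"
  define u where "u j = phase (of_int (j * j) * t + of_int j * z)" for j :: int
  define S where "S = (\<Sum>j\<in>J. u j)"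
  have "of_real ((norm S)\<^sup>2) = S * cnj S"
    by (rule complex_norm_square)
  also have "\<dots> = (\<Sum>p\<in>J \<times> J. u (fst p) * cnj (u (snd p)))"
    by (simp add: S_def sum_product sum.cartesian_product split_beta)
  also have "\<dots> = (\<Sum>h\<in>T. \<Sum>p\<in>{p \<in> J \<times> J. fst p - snd p = h}. u (fst p) * cnj (u (snd p)))"
    by (rule sum.group[symmetric]) (auto simp: J_def T_def)
  also have "\<dots> = (\<Sum>h\<in>T. \<Sum>l\<in>{max (- int R) (- int R - h)..min (int R) (int R - h)}.
      phase (of_int (h * h) * t + of_int h * z) * phase (of_int l * (of_int (2 * h) * t)))"
  proof (rule sum.cong[OF refl])
    fix h assume "h \<in> T"
    show "(\<Sum>p\<in>{p \<in> J \<times> J. fst p - snd p = h}. u (fst p) * cnj (u (snd p))) =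
      (\<Sum>l\<in>{max (- int R) (- int R - h)..min (int R) (int R - h)}.
      phase (of_int (h * h) * t + of_int h * z) * phase (of_int l * (of_int (2 * h) * t)))"
    proof (rule sum.reindex_bij_witness[where i = "\<lambda>l. (l + h, l)" and j = snd])
      fix p assume "p \<in> {p \<in> J \<times> J. fst p - snd p = h}"
      then obtain l where p: "p = (l + h, l)" by (cases p) (auto simp: algebra_simps)
      show "phase (of_int (h * h) * t + of_int h * z) * phase (of_int (snd p) * (of_int (2 * h) * t))
              = u (fst p) * cnj (u (snd p))"
        unfolding p u_def cnj_phase phase_add[symmetric] by (simp add: algebra_simps)
    qed (auto simp: J_def)
  qed
  finally have eq: "of_real ((norm S)\<^sup>2) = (\<Sum>h\<in>T.
      phase (of_int (h * h) * t + of_int h * z) *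
      (\<Sum>l\<in>{max (- int R) (- int R - h)..min (int R) (int R - h)}.
          phase (of_int l * (of_int (2 * h) * t))))" (is "_ = ?rhs")
    by (simp add: sum_distrib_left)
  have "(norm S)\<^sup>2 = norm (of_real ((norm S)\<^sup>2) :: complex)"
    by (simp only: norm_of_real) simp
  also have "\<dots> = norm ?rhs"
    by (simp only: eq)
  also have "\<dots> \<le> (\<Sum>h\<in>T. spike (real L) (of_int (2 * h) * t))"
  proof (intro sum_norm_le)
    fix h
    show "norm (phase (of_int (h * h) * t + of_int h * z) *
        (\<Sum>l\<in>{max (- int R) (- int R - h)..min (int R) (int R - h)}.
          phase (of_int l * (of_int (2 * h) * t)))) \<le> spike (real L) (of_int (2 * h) * t)"
      unfolding norm_mult norm_phase mult_1 by (rule norm_phase_sum_le) (auto simp: L_def)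
  qed
  also have "T = insert 0 ((\<lambda>h. - int h) ` {1..2 * R} \<union> int ` {1..2 * R})"
  proof (intro equalityI subsetI)
    fix h assume h: "h \<in> T"
    consider "h = 0" | "h > 0" | "h < 0" by linarith
    then show "h \<in> insert 0 ((\<lambda>h. - int h) ` {1..2 * R} \<union> int ` {1..2 * R})"
    proof cases
      case 2
      then have "h = int (nat h)" "nat h \<in> {1..2 * R}" using h by (auto simp: T_def)
      then show ?thesis by blast
    next
      case 3
      then have "h = - int (nat (- h))" "nat (- h) \<in> {1..2 * R}" using h by (auto simp: T_def)
      then show ?thesis by blast
    qed auto
  qed (auto simp: T_def)
  also have "(\<Sum>h\<in>\<dots>. spike (real L) (of_int (2 * h) * t)) =
      spike (real L) 0 + 2 * (\<Sum>h=1..2 * R. spike (real L) (real (2 * h) * t))"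
    by (subst sum.insert; (subst sum.union_disjoint)?)
       (auto simp: sum.reindex inj_on_def spike_def)
  also have "(\<Sum>h=1..2 * R. spike (real L) (real (2 * h) * t)) \<le>
      (\<Sum>h=1..2 * R. spike (real (2 * L)) (real (2 * h) * t))"
    by (intro sum_mono spike_mono) (auto simp: L_def)
  also have "\<dots> = (\<Sum>h\<in>(*) 2 ` {1..2 * R}. spike (real (2 * L)) (real h * t))"
    by (subst sum.reindex) (auto simp: inj_on_def)
  also have "\<dots> \<le> spike_sum (2 * L) t"
    unfolding spike_sum_def by (rule sum_mono2) (auto simp: L_def)
  also have "spike (real L) 0 \<le> real (2 * L)"
    using spike_le[of "real L" 0] by simp
  also have "\<dots> \<le> spike_sum (2 * L) t"
    by (rule le_spike_sum)
  finally show ?thesis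
    by (simp add: S_def u_def J_def L_def)
qed

section \<open>Spike sums near a rational number\<close>

lemma sum_inverse_sqrt_le: "(\<Sum>j=1..J. 1 / sqrt (real j)) \<le> 2 * sqrt (real J)"
proof (induction J)
  case 0
  then show ?case by simp
next
  case (Suc J)
  have "1 / sqrt (real (Suc J)) = 2 * (real (Suc J) - real J) / (2 * sqrt (real (Suc J)))"
    by simp
  also have "\<dots> = 2 * ((sqrt (Suc J) - sqrt J) * (sqrt (Suc J) + sqrt J)) / (2 * sqrt (Suc J))"
    by (simp add: algebra_simps)
  also have "\<dots> \<le> 2 * ((sqrt (Suc J) - sqrt J) * (2 * sqrt (Suc J))) / (2 * sqrt (Suc J))"
    by (intro divide_right_mono mult_left_mono) auto
  also have "\<dots> = 2 * (sqrt (Suc J) - sqrt J)"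
    by simp
  finally show ?case using Suc.IH by simp
qed

lemma harm_le_1_ln:
  assumes "1 \<le> n"
  shows "harm n \<le> 1 + ln (real n)"
proof -
  obtain m where m: "n = Suc m" using assms by (cases n) auto
  have "harm (Suc m) - ln (real (Suc m)) \<le> harm (Suc 0) - ln (real (Suc 0))"
    using decseq_harm_diff_ln by (rule decseqD) simp
  then show ?thesis by (simp add: m harm_Suc harm_expand)
qed

text \<open>
  Let \<open>b = t - a/q\<close>. For \<open>h = jq\<close> the number \<open>ht\<close> lies at distance \<open>jq|b|\<close> from \<open>ja\<close>, so the spikes are
  as large as \<open>t\<close> is close to \<open>a/q\<close>. Summing \<open>1 / (jq|b|)\<close> over \<open>j\<close> would bring in a
  logarithm. The cruder \<open>max 1 x \<ge> sqrt (max 1 x)\<close> avoids it at the price of the slower decay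
  \<open>(H\<^sup>2|b|)\<^bsup>-1/2\<^esup>\<close>, whose powers of exponent above \<open>2\<close> are still integrable in \<open>b\<close>.
\<close>

lemma spike_sum_multiples_le:
  fixes H q :: nat and a :: int and t :: real
  assumes q: "1 \<le> q" and H: "1 \<le> H"
    and t: "\<bar>t - of_int a / real q\<bar> \<le> 1 / (4 * real H * real q)"
  shows "(\<Sum>h\<in>{h \<in> {1..H}. q dvd h}. spike (real H) (real h * t))
           \<le> 2 * (real H)\<^sup>2 / real q / sqrt (max 1 ((real H)\<^sup>2 * \<bar>t - of_int a / real q\<bar>))"
proof -
  define b where "b = t - of_int a / real q"
  define m where "m = max 1 ((real H)\<^sup>2 * \<bar>b\<bar>)"
  have m: "1 \<le> m" by (simp add: m_def)
  have set_eq: "{h \<in> {1..H}. q dvd h} = (\<lambda>j. j * q) ` {1..H div q}"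
  proof (intro equalityI subsetI)
    fix h assume "h \<in> {h \<in> {1..H}. q dvd h}"
    then obtain j where "h = j * q" "1 \<le> h" "h \<le> H" by (auto elim!: dvdE simp: mult.commute)
    moreover from this have "j \<in> {1..H div q}"
      using q by (auto simp: less_eq_div_iff_mult_less_eq intro: Suc_leI)
    ultimately show "h \<in> (\<lambda>j. j * q) ` {1..H div q}" by blast
  next
    fix h assume "h \<in> (\<lambda>j. j * q) ` {1..H div q}"
    then show "h \<in> {h \<in> {1..H}. q dvd h}"
      using q by (auto simp: less_eq_div_iff_mult_less_eq)
  qed
  have "(\<Sum>h\<in>{h \<in> {1..H}. q dvd h}. spike (real H) (real h * t))
      = (\<Sum>j=1..H div q. spike (real H) (real (j * q) * t))"
    unfolding set_eq using q by (subst sum.reindex) (auto simp: inj_on_def)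
  also have "\<dots> \<le> (\<Sum>j=1..H div q. real H * sqrt (real H / real q) / sqrt m * (1 / sqrt (real j)))"
  proof (rule sum_mono)
    fix j assume "j \<in> {1..H div q}"
    then have j: "1 \<le> j" "j * q \<le> H"
      using q by (auto simp: less_eq_div_iff_mult_less_eq)
    have jq: "real j * real q \<le> real H"
      using j(2) by (metis of_nat_mult of_nat_le_iff)
    have pos: "0 < real H" "0 < real q" "0 < real j" using q H j by auto
    have "\<bar>b\<bar> * (real j * real q) \<le> 1 / (4 * real H * real q) * (real j * real q)"
      using t unfolding b_def by (intro mult_right_mono) auto
    also have "\<dots> \<le> 1 / (4 * real H * real q) * real H"
      using jq by (intro mult_left_mono) auto
    also have "\<dots> \<le> 1 / 4" using pos q by (simp add: field_simps)
    finally have small: "\<bar>b\<bar> * (real j * real q) \<le> 1 / 4" .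
    have dist: "real (j * q) * t - of_int (int j * a) = real j * real q * b"
      using pos by (simp add: b_def field_simps)
    have id: "int_dist (real (j * q) * t) = real j * real q * \<bar>b\<bar>"
      using small pos dist by (subst int_dist_eq[of _ "int j * a"]) (auto simp: abs_mult mult_ac)
    define w where "w = real j * real q / real H"
    have w: "0 < w" "w \<le> 1" using pos jq by (auto simp: w_def)
    \<comment> \<open>As \<open>w \<le> 1\<close>, the maximum \<open>m\<close> can be pulled out of the spike for all \<open>j\<close> at once.\<close>
    have "w * m \<le> max 1 (real H * (real j * real q * \<bar>b\<bar>))"
    proof (cases "1 \<le> (real H)\<^sup>2 * \<bar>b\<bar>")
      case True
      then have "w * m = real H * (real j * real q * \<bar>b\<bar>)"
        using pos by (simp add: m_def w_def power2_eq_square)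
      then show ?thesis by simp
    next
      case False
      then show ?thesis using w by (simp add: m_def)
    qed
    also have "\<dots> \<le> (max 1 (real H * (real j * real q * \<bar>b\<bar>)))\<^sup>2"
      by (intro self_le_power) auto
    finally have "sqrt (w * m) \<le> max 1 (real H * (real j * real q * \<bar>b\<bar>))"
      by (intro real_le_lsqrt) auto
    then have "spike (real H) (real (j * q) * t) \<le> real H / sqrt (w * m)"
      unfolding spike_def id using w m pos by (intro divide_left_mono) auto
    also have "\<dots> = real H * sqrt (real H / real q) / sqrt m * (1 / sqrt (real j))"
      using pos by (simp add: w_def real_sqrt_mult real_sqrt_divide)
    finally show "spike (real H) (real (j * q) * t)
        \<le> real H * sqrt (real H / real q) / sqrt m * (1 / sqrt (real j))" .
  qed
  also have "\<dots> = real H * sqrt (real H / real q) / sqrt m * (\<Sum>j=1..H div q. 1 / sqrt (real j))"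
    by (simp only: sum_distrib_left)
  also have "\<dots> \<le> real H * sqrt (real H / real q) / sqrt m * (2 * sqrt (real (H div q)))"
    using m by (intro mult_left_mono sum_inverse_sqrt_le) auto
  also have "\<dots> \<le> real H * sqrt (real H / real q) / sqrt m * (2 * sqrt (real H / real q))"
    using m of_nat_div_le_of_nat[of H q, where 'a = real]
    by (intro mult_left_mono) (auto simp: real_sqrt_le_iff)
  also have "\<dots> = 2 * (real H)\<^sup>2 / real q / sqrt m"
    using q by (simp add: power2_eq_square real_sqrt_divide field_simps)
  finally show ?thesis by (simp add: m_def b_def)
qed

text \<open>
  Multiplication by \<open>a\<close> permutes the residues modulo \<open>q\<close>, so each residue is hit at most once in every block
  of \<open>q\<close> consecutive integers.
\<close>

lemma card_residue_le:
  fixes H q :: nat and a :: int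
  assumes q: "1 \<le> q" and a: "coprime a (int q)"
  shows "card {h \<in> {1..H}. (int h * a) mod int q = r} \<le> H div q + 1"
proof -
  have "inj_on (\<lambda>h. h div q) {h \<in> {1..H}. (int h * a) mod int q = r}"
  proof (rule inj_onI)
    fix h h' assume A: "h \<in> {h \<in> {1..H}. (int h * a) mod int q = r}"
      "h' \<in> {h \<in> {1..H}. (int h * a) mod int q = r}" and d: "h div q = h' div q"
    then have "(int h * a) mod int q = (int h' * a) mod int q"
      by simp
    then have "int q dvd (int h - int h') * a"
      by (simp only: mod_eq_dvd_iff left_diff_distrib)
    then have "int q dvd int h - int h'"
      using a by (simp add: coprime_dvd_mult_left_iff coprime_commute)
    then have "int (h mod q) = int (h' mod q)"
      by (simp add: mod_eq_dvd_iff zmod_int)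
    then have "h mod q = h' mod q"
      by simp
    with d show "h = h'"
      by (metis div_mult_mod_eq)
  qed
  moreover have "(\<lambda>h. h div q) ` {h \<in> {1..H}. (int h * a) mod int q = r} \<subseteq> {0..H div q}"
    by (auto intro: div_le_mono)
  ultimately show ?thesis
    using card_inj_on_le[of "\<lambda>h. h div q" _ "{0..H div q}"] by fastforce
qed

text \<open>
  If \<open>q\<close> does not divide \<open>h\<close>, then \<open>ha/q\<close> is at distance at least \<open>1/q\<close> from the integers, while \<open>ht\<close>
  differs from it by at most \<open>1/(4q)\<close>. The spike is thus controlled by the residue \<open>r\<close> of \<open>ha\<close>, through
  \<open>q/r + q/(q - r)\<close>, and no residue occurs more than \<open>H/q + 1\<close> times.
\<close>

lemma spike_sum_nonmultiples_le:
  fixes H q :: nat and a :: int and t :: real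
  assumes q: "1 \<le> q" and H: "1 \<le> H" and a: "coprime a (int q)"
    and t: "\<bar>t - of_int a / real q\<bar> \<le> 1 / (4 * real H * real q)"
  shows "(\<Sum>h\<in>{h \<in> {1..H}. \<not> q dvd h}. spike (real H) (real h * t))
           \<le> 8 / 3 * (real H + real q) * harm q"
proof -
  define A where "A = {h \<in> {1..H}. \<not> q dvd h}"
  define \<rho> where "\<rho> h = (int h * a) mod int q" for h :: nat
  define \<phi> where "\<phi> r = real q / of_int r + real q / of_int (int q - r)" for r :: int
  define b where "b = t - of_int a / real q"
  have \<rho>: "\<rho> h \<in> {1..int q - 1}" if "h \<in> A" for h
  proof -
    have "\<not> int q dvd int h * a"
      using that a by (auto simp: A_def coprime_dvd_mult_left_iff coprime_commute)
    then have "\<rho> h \<noteq> 0" by (simp add: \<rho>_def dvd_eq_mod_eq_0)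
    moreover have "0 \<le> \<rho> h" "\<rho> h < int q" using q by (auto simp: \<rho>_def)
    ultimately show ?thesis by auto
  qed
  have bound: "spike (real H) (real h * t) \<le> 4 / 3 * \<phi> (\<rho> h)" if h: "h \<in> A" for h
  proof -
    define \<mu> where "\<mu> = min (\<rho> h) (int q - \<rho> h)"
    have \<mu>: "1 \<le> \<mu>" using \<rho>[OF h] by (auto simp: \<mu>_def)
    define x where "x = real h * (of_int a / real q)"
    have "of_int \<mu> / real q \<le> int_dist x"
    proof -
      define D where "D = (int h * a) div int q - round x"
      have eq: "int h * a - round x * int q = int q * D + \<rho> h"
        by (simp add: D_def \<rho>_def algebra_simps)
      have "\<mu> \<le> \<bar>int q * D + \<rho> h\<bar>"
      proof (cases "0 \<le> D")
        case True
        then have "0 \<le> int q * D" by simp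
        then show ?thesis using \<rho>[OF h] by (auto simp: \<mu>_def)
      next
        case False
        then have "int q * D \<le> int q * (- 1)" by (intro mult_left_mono) auto
        then show ?thesis using \<rho>[OF h] by (auto simp: \<mu>_def)
      qed
      then have "real_of_int \<mu> \<le> \<bar>of_int (int h * a - round x * int q)\<bar>"
        unfolding eq by linarith
      then have "of_int \<mu> / real q \<le> \<bar>of_int (int h * a - round x * int q)\<bar> / real q"
        by (intro divide_right_mono) auto
      also have "\<dots> = \<bar>of_int (int h * a - round x * int q) / real q\<bar>"
        by simp
      also have "of_int (int h * a - round x * int q) / real q = x - of_int (round x)"
        using q by (simp add: x_def field_simps)
      finally show ?thesis by (simp add: int_dist_def)
    qed
    moreover have "1 / real q \<le> of_int \<mu> / real q"
      using \<mu> by (intro divide_right_mono) auto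
    moreover have "\<bar>real h * b\<bar> \<le> 1 / (4 * real q)"
    proof -
      have "\<bar>real h * b\<bar> \<le> real H * (1 / (4 * real H * real q))"
        using h t unfolding abs_mult by (intro mult_mono) (auto simp: A_def b_def)
      then show ?thesis using H by simp
    qed
    moreover have "real h * t = x + real h * b"
      by (simp add: x_def b_def algebra_simps)
    ultimately have d: "3 / 4 * (of_int \<mu> / real q) \<le> int_dist (real h * t)"
      using int_dist_ge_minus[of x "real h * b"] by (simp add: field_simps)
    have pos: "0 < 3 / 4 * (of_int \<mu> / real q)"
      using \<mu> q by auto
    have "spike (real H) (real h * t) \<le> 1 / int_dist (real h * t)"
      using d pos H by (intro spike_le_inverse) auto
    also have "\<dots> \<le> 1 / (3 / 4 * (of_int \<mu> / real q))"
      using d pos by (intro divide_left_mono mult_pos_pos) linarith+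
    also have "\<dots> = 4 / 3 * (real q / of_int \<mu>)"
      by simp
    also have "real q / of_int \<mu> \<le> \<phi> (\<rho> h)"
      using \<rho>[OF h] by (auto simp: \<mu>_def \<phi>_def min_def)
    finally show ?thesis by simp
  qed
  have \<phi>_nonneg: "0 \<le> \<phi> r" if "r \<in> {1..int q - 1}" for r
    using that by (auto simp: \<phi>_def)
  have fin: "finite A" by (simp add: A_def)
  have "(\<Sum>h\<in>A. spike (real H) (real h * t)) \<le> (\<Sum>h\<in>A. 4 / 3 * \<phi> (\<rho> h))"
    by (intro sum_mono bound)
  also have "\<dots> = (\<Sum>r\<in>{1..int q - 1}. \<Sum>h\<in>{h \<in> A. \<rho> h = r}. 4 / 3 * \<phi> (\<rho> h))"
    using \<rho> fin by (intro sum.group[symmetric]) auto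
  also have "\<dots> = (\<Sum>r\<in>{1..int q - 1}. real (card {h \<in> A. \<rho> h = r}) * (4 / 3 * \<phi> r))"
    by simp
  also have "\<dots> \<le> (\<Sum>r\<in>{1..int q - 1}. (real H / real q + 1) * (4 / 3 * \<phi> r))"
  proof (intro sum_mono mult_right_mono)
    fix r assume "r \<in> {1..int q - 1}"
    then show "0 \<le> 4 / 3 * \<phi> r" using \<phi>_nonneg by auto
    have "card {h \<in> A. \<rho> h = r} \<le> card {h \<in> {1..H}. (int h * a) mod int q = r}"
      by (intro card_mono) (auto simp: A_def \<rho>_def)
    also have "\<dots> \<le> H div q + 1" by (rule card_residue_le[OF q a])
    finally have "real (card {h \<in> A. \<rho> h = r}) \<le> real (H div q) + 1" by linarith
    also have "\<dots> \<le> real H / real q + 1" using of_nat_div_le_of_nat[of H q, where 'a = real] by simp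
    finally show "real (card {h \<in> A. \<rho> h = r}) \<le> real H / real q + 1" .
  qed
  also have "\<dots> = 4 / 3 * (real H / real q + 1) * (\<Sum>r\<in>{1..int q - 1}. \<phi> r)"
    by (subst sum_distrib_left) (simp only: mult_ac)
  also have "(\<Sum>r\<in>{1..int q - 1}. \<phi> r)
      = (\<Sum>r\<in>{1..int q - 1}. real q / of_int r) + (\<Sum>r\<in>{1..int q - 1}. real q / of_int (int q - r))"
    by (simp add: \<phi>_def sum.distrib)
  also have "(\<Sum>r\<in>{1..int q - 1}. real q / of_int (int q - r)) = (\<Sum>r\<in>{1..int q - 1}. real q / of_int r)"
    by (rule sum.reindex_bij_witness[where i = "\<lambda>r. int q - r" and j = "\<lambda>r. int q - r"]) auto
  also have "(\<Sum>r\<in>{1..int q - 1}. real q / of_int r) = (\<Sum>r=1..q - 1. real q / real r)"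
    by (rule sum.reindex_bij_witness[where i = int and j = nat]) (use q in auto)
  also have "\<dots> = real q * harm (q - 1)"
    by (simp add: harm_def sum_distrib_left divide_inverse)
  also have "4 / 3 * (real H / real q + 1) * (real q * harm (q - 1) + real q * harm (q - 1))
      = 8 / 3 * (real H + real q) * harm (q - 1)"
    using q by (simp add: field_simps)
  also have "\<dots> \<le> 8 / 3 * (real H + real q) * harm q"
    by (intro mult_left_mono harm_mono) auto
  finally show ?thesis by (simp add: A_def)
qed

text \<open>
  The major arc term is the contribution of the multiples of \<open>q\<close>; the rest is of order \<open>H log H\<close>
  at most, whatever \<open>t\<close> is.
\<close>

lemma spike_sum_le:
  fixes H q :: nat and a :: int and t :: real
  assumes q: "1 \<le> q" "q \<le> 4 * H" and H: "1 \<le> H" and a: "coprime a (int q)"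
    and t: "\<bar>t - of_int a / real q\<bar> \<le> 1 / (4 * real H * real q)"
  shows "spike_sum H t
           \<le> 2 * (real H)\<^sup>2 / real q / sqrt (max 1 ((real H)\<^sup>2 * \<bar>t - of_int a / real q\<bar>))
             + 14 * real H * (1 + ln (4 * real H))"
proof -
  have "spike_sum H t = (\<Sum>h\<in>{h \<in> {1..H}. q dvd h} \<union> {h \<in> {1..H}. \<not> q dvd h}.
      spike (real H) (real h * t))"
    unfolding spike_sum_def by (rule sum.cong) auto
  also have "\<dots> = (\<Sum>h\<in>{h \<in> {1..H}. q dvd h}. spike (real H) (real h * t))
      + (\<Sum>h\<in>{h \<in> {1..H}. \<not> q dvd h}. spike (real H) (real h * t))"
    by (rule sum.union_disjoint) auto
  finally have "spike_sum H t \<le>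
      2 * (real H)\<^sup>2 / real q / sqrt (max 1 ((real H)\<^sup>2 * \<bar>t - of_int a / real q\<bar>))
      + 8 / 3 * (real H + real q) * harm q"
    using spike_sum_multiples_le[OF q(1) H t] spike_sum_nonmultiples_le[OF q(1) H a t] by linarith
  moreover have "8 / 3 * (real H + real q) * harm q \<le> 14 * real H * (1 + ln (4 * real H))"
  proof (rule mult_mono)
    \<comment> \<open>From \<open>q \<le> 4 H\<close>: the left side is at most \<open>(40/3) H\<close>.\<close>
    show "8 / 3 * (real H + real q) \<le> 14 * real H"
      using q by simp
    have "harm q \<le> 1 + ln (real q)" using q by (intro harm_le_1_ln)
    also have "\<dots> \<le> 1 + ln (4 * real H)" using q by simp
    finally show "harm q \<le> 1 + ln (4 * real H)" .
  qed (auto intro: harm_nonneg)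
  ultimately show ?thesis by linarith
qed

section \<open>Moments of spike sums\<close>

lemma nn_integral_max_powr_finite:
  assumes "1 < s"
  shows "(\<integral>\<^sup>+u. ennreal (max 1 \<bar>u\<bar> powr (- s)) \<partial>lborel) < \<infinity>"
proof -
  define g where "g u = (if u \<in> {1..} then u powr (- s) else 0)" for u :: real
  have g [measurable]: "g \<in> borel_measurable borel"
    unfolding g_def[abs_def] by measurable
  have "(g has_integral (- (1 powr (- s + 1)) / (- s + 1))) UNIV"
    unfolding g_def[abs_def] has_integral_restrict_UNIV
    using assms by (intro has_integral_powr_to_inf) auto
  then have 1: "(\<integral>\<^sup>+u. ennreal (g u) \<partial>lborel) < \<infinity>"
    by (subst nn_integral_has_integral_lborel[OF g]) (auto simp: g_def)
  have 2: "(\<integral>\<^sup>+u. ennreal (g u) \<partial>lborel) = (\<integral>\<^sup>+u. ennreal (g (- u)) \<partial>lborel)"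
    using nn_integral_real_affine[of "\<lambda>u. ennreal (g u)" "- 1" 0] by simp
  have "(\<integral>\<^sup>+u. ennreal (max 1 \<bar>u\<bar> powr (- s)) \<partial>lborel)
      \<le> (\<integral>\<^sup>+u. indicator {-1..1} u + ennreal (g u) + ennreal (g (- u)) \<partial>lborel)"
    by (intro nn_integral_mono) (auto simp: g_def indicator_def max_def abs_if ennreal_1[symmetric] simp del: ennreal_1)
  also have "\<dots> = emeasure lborel {-1..1::real}
      + (\<integral>\<^sup>+u. ennreal (g u) \<partial>lborel) + (\<integral>\<^sup>+u. ennreal (g (- u)) \<partial>lborel)"
    by (simp add: nn_integral_add)
  also have "\<dots> < \<infinity>"
    using 1 unfolding 2[symmetric] by simp
  finally show ?thesis .
qed

text \<open>
  A bump of width \<open>1/c\<close> has integral proportional to \<open>1/c\<close>, wherever it is centred. Below, \<open>c = H\<^sup>2\<close>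
  and the centres are the rationals \<open>a/q\<close>.
\<close>

lemma nn_integral_scaled_bump:
  assumes "1 < s"
  obtains K where "0 \<le> K"
    "\<And>c b. 0 < c \<Longrightarrow> (\<integral>\<^sup>+t. ennreal (max 1 (c * \<bar>t - b\<bar>) powr (- s)) \<partial>lborel) = ennreal (K / c)"
proof -
  define I where "I = (\<integral>\<^sup>+u. ennreal (max 1 \<bar>u\<bar> powr (- s)) \<partial>lborel)"
  have I: "I < \<infinity>" unfolding I_def by (rule nn_integral_max_powr_finite[OF assms])
  have "(\<integral>\<^sup>+t. ennreal (max 1 (c * \<bar>t - b\<bar>) powr (- s)) \<partial>lborel) = ennreal (enn2real I / c)"
    if c: "0 < c" for c b
  proof -
    have "I = ennreal \<bar>c\<bar> * (\<integral>\<^sup>+t. ennreal (max 1 \<bar>- (c * b) + c * t\<bar> powr (- s)) \<partial>lborel)"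
      unfolding I_def using c by (intro nn_integral_real_affine) auto
    moreover have "\<bar>- (c * b) + c * t\<bar> = c * \<bar>t - b\<bar>" for t
    proof -
      have "- (c * b) + c * t = c * (t - b)" by (simp add: algebra_simps)
      then show ?thesis using c by (simp add: abs_mult)
    qed
    ultimately have eq: "I = ennreal c * (\<integral>\<^sup>+t. ennreal (max 1 (c * \<bar>t - b\<bar>) powr (- s)) \<partial>lborel)"
      using c by simp
    have "ennreal (enn2real I / c) = ennreal (1 / c) * I"
      using c by (subst (2) ennreal_enn2real[symmetric, OF I[unfolded infinity_ennreal_def]])
        (simp add: ennreal_mult'[symmetric])
    also have "\<dots> = (ennreal (1 / c) * ennreal c) * (\<integral>\<^sup>+t. ennreal (max 1 (c * \<bar>t - b\<bar>) powr (- s)) \<partial>lborel)"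
      by (subst eq) (simp only: mult.assoc)
    also have "ennreal (1 / c) * ennreal c = 1"
      using c by (simp add: ennreal_mult'[symmetric])
    finally show ?thesis by simp
  qed
  then show ?thesis by (intro that[of "enn2real I"]) auto
qed

lemma powr_add_le:
  fixes x y s :: real
  assumes "0 \<le> x" "0 \<le> y" "0 \<le> s"
  shows "(x + y) powr s \<le> 2 powr s * (x powr s + y powr s)"
proof -
  have "(x + y) powr s \<le> (2 * max x y) powr s"
    using assms by (intro powr_mono2) auto
  also have "\<dots> = 2 powr s * max x y powr s"
    using assms by (simp add: powr_mult)
  also have "max x y powr s \<le> x powr s + y powr s"
    by (auto simp: max_def)
  finally show ?thesis by simp
qed

text \<open>
  Dirichlet's theorem provides one good fraction \<open>a/q\<close> with \<open>q \<le> 4H\<close> for each \<open>t\<close>. Summing over all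
  fractions instead makes the majorant a function of \<open>t\<close> that can be integrated term by term, so
  the arcs need not be disjoint.
\<close>

lemma spike_sum_powr_le:
  fixes H :: nat and t \<sigma> :: real
  assumes H: "1 \<le> H" and t: "t \<in> {0..1}" and \<sigma>: "0 \<le> \<sigma>"
  shows "spike_sum H t powr \<sigma>
    \<le> 2 powr \<sigma> * (\<Sum>q=1..4 * H. \<Sum>a=0..q. (2 * (real H)\<^sup>2 / real q) powr \<sigma> *
          max 1 ((real H)\<^sup>2 * \<bar>t - real a / real q\<bar>) powr (- (\<sigma> / 2)))
      + 2 powr \<sigma> * (14 * real H * (1 + ln (4 * real H))) powr \<sigma>"
proof -
  obtain a k where ak: "coprime a k" "0 < k" "k \<le> int (4 * H)" "\<bar>of_int k * t - of_int a\<bar> < 1 / (4 * H)"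
    using Dirichlet_approx_coprime[of "4 * H" t] H by auto
  define q where "q = nat k"
  have q: "k = int q" "1 \<le> q" "q \<le> 4 * H" using ak by (auto simp: q_def)
  have small: "1 / real (4 * H) < 1" using H by simp
  have kt: "0 \<le> of_int k * t" "of_int k * t \<le> of_int k"
    using t ak by (auto simp: mult_left_le)
  have "real_of_int a < of_int k + 1" using ak(4) small kt by linarith
  then have a1: "a \<le> k" by linarith
  have "- 1 < real_of_int a" using ak(4) small kt by linarith
  then have a0: "0 \<le> a" by linarith
  define n where "n = nat a"
  have n: "a = int n" "n \<le> q" using a0 a1 q by (auto simp: n_def)
  have "\<bar>t - of_int a / real q\<bar> = \<bar>of_int k * t - of_int a\<bar> / real q"
  proof -
    have "t - of_int a / real q = (of_int k * t - of_int a) / real q"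
      using q by (simp add: field_simps)
    then show ?thesis by simp
  qed
  also have "\<dots> \<le> (1 / (4 * H)) / real q"
    using ak(4) by (intro divide_right_mono) auto
  finally have approx: "\<bar>t - of_int a / real q\<bar> \<le> 1 / (4 * real H * real q)" by simp
  define m where "m = max 1 ((real H)\<^sup>2 * \<bar>t - of_int a / real q\<bar>)"
  define X where "X = 2 * (real H)\<^sup>2 / real q / sqrt m"
  define Y where "Y = 14 * real H * (1 + ln (4 * real H))"
  have m: "1 \<le> m" by (simp add: m_def)
  have XY: "0 \<le> X" "0 \<le> Y" using m H by (auto simp: X_def Y_def)
  have "spike_sum H t \<le> X + Y"
    unfolding X_def Y_def m_def using approx q ak(1) H by (intro spike_sum_le) auto
  then have "spike_sum H t powr \<sigma> \<le> (X + Y) powr \<sigma>"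
    using \<sigma> by (intro powr_mono2) auto
  also have "\<dots> \<le> 2 powr \<sigma> * (X powr \<sigma> + Y powr \<sigma>)"
    by (rule powr_add_le[OF XY \<sigma>])
  also have "X powr \<sigma> = (2 * (real H)\<^sup>2 / real q) powr \<sigma> * m powr (- (\<sigma> / 2))"
  proof -
    have "sqrt m powr \<sigma> = m powr (\<sigma> / 2)"
      using m by (simp add: powr_half_sqrt[symmetric] powr_powr)
    then show ?thesis
      using m by (simp add: X_def powr_divide powr_minus_divide powr_mult)
  qed
  also have "\<dots> \<le> (\<Sum>a=0..q. (2 * (real H)\<^sup>2 / real q) powr \<sigma> *
          max 1 ((real H)\<^sup>2 * \<bar>t - real a / real q\<bar>) powr (- (\<sigma> / 2)))"
    using member_le_sum[of n "{0..q}" "\<lambda>a. (2 * (real H)\<^sup>2 / real q) powr \<sigma> *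
          max 1 ((real H)\<^sup>2 * \<bar>t - real a / real q\<bar>) powr (- (\<sigma> / 2))"] n
    by (simp add: m_def)
  also have "\<dots> \<le> (\<Sum>q=1..4 * H. \<Sum>a=0..q. (2 * (real H)\<^sup>2 / real q) powr \<sigma> *
          max 1 ((real H)\<^sup>2 * \<bar>t - real a / real q\<bar>) powr (- (\<sigma> / 2)))"
    using q by (intro member_le_sum[of q "{1..4 * H}"]) (auto intro!: sum_nonneg)
  finally show ?thesis
    by (simp add: Y_def ring_distribs)
qed

text \<open>
  A logarithm is harmless here, because \<open>\<sigma> < 2\<sigma> - 2\<close> leaves room for a small power of \<open>H\<close>.
\<close>

lemma minor_arc_powr_le:
  fixes \<sigma> :: real
  assumes \<sigma>: "2 < \<sigma>"
  obtains C where "0 \<le> C"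
    "\<And>H::nat. 1 \<le> H \<Longrightarrow> (14 * real H * (1 + ln (4 * real H))) powr \<sigma> \<le> C * real H powr (2 * \<sigma> - 2)"
proof -
  \<comment> \<open>This choice satisfies \<open>(1 + \<eta>) \<sigma> = 2\<sigma> - 2\<close>.\<close>
  define \<eta> where "\<eta> = 1 - 2 / \<sigma>"
  have \<eta>: "0 < \<eta>" using \<sigma> by (simp add: \<eta>_def)
  define B where "B = 14 * (4 + 1 / \<eta>)"
  have "(14 * real H * (1 + ln (4 * real H))) powr \<sigma> \<le> B powr \<sigma> * real H powr (2 * \<sigma> - 2)"
    if H: "1 \<le> H" for H :: nat
  proof -
    have 1: "1 \<le> real H powr \<eta>" using H \<eta> by (simp add: ge_one_powr_ge_zero)
    have "ln (4 * real H) = ln 4 + ln (real H)" using H by (simp add: ln_mult)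
    also have "ln (4::real) \<le> 3" using ln_le_minus_one[of "4::real"] by simp
    also have "ln (real H) \<le> real H powr \<eta> / \<eta>" using H \<eta> by (intro ln_powr_bound) auto
    finally have "1 + ln (4 * real H) \<le> 4 * 1 + real H powr \<eta> / \<eta>" by simp
    also have "\<dots> \<le> (4 + 1 / \<eta>) * real H powr \<eta>" using 1 by (simp add: ring_distribs)
    finally have "14 * real H * (1 + ln (4 * real H)) \<le> 14 * real H * ((4 + 1 / \<eta>) * real H powr \<eta>)"
      by (intro mult_left_mono) auto
    also have "\<dots> = B * real H powr (1 + \<eta>)"
      using H by (simp add: B_def powr_add)
    finally have "(14 * real H * (1 + ln (4 * real H))) powr \<sigma> \<le> (B * real H powr (1 + \<eta>)) powr \<sigma>"
      using \<sigma> H by (intro powr_mono2) auto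
    also have "\<dots> = B powr \<sigma> * real H powr ((1 + \<eta>) * \<sigma>)"
      using \<eta> by (subst powr_mult) (auto simp: B_def powr_powr)
    also have "(1 + \<eta>) * \<sigma> = 2 * \<sigma> - 2"
      using \<sigma> by (simp add: \<eta>_def field_simps)
    finally show ?thesis .
  qed
  then show ?thesis by (intro that[of "B powr \<sigma>"]) auto
qed

text \<open>
  The arc around \<open>a/q\<close> has height \<open>H\<^sup>2/q\<close> and width \<open>H\<^bsup>-2\<^esup>\<close>, and there are about \<open>q\<close> of them, so the
  integral is \<open>H\<^bsup>2\<sigma> - 2\<^esup>\<close> times the sum of \<open>q\<^bsup>1 - \<sigma>\<^esup>\<close>, which converges exactly for \<open>\<sigma> > 2\<close>. The same
  condition makes the bumps, which decay like \<open>|u|\<^bsup>-\<sigma>/2\<^esup>\<close>, integrable. This is where the range of \<open>p\<close>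
  in the main result comes from.
\<close>

lemma spike_sum_moment_le:
  fixes \<sigma> :: real
  assumes \<sigma>: "2 < \<sigma>"
  obtains C where "0 < C"
    "\<And>H::nat. 1 \<le> H \<Longrightarrow> (\<integral>\<^sup>+t\<in>{0..1}. ennreal (spike_sum H t powr \<sigma>) \<partial>lborel)
       \<le> ennreal (C * real H powr (2 * \<sigma> - 2))"
proof -
  obtain K where K: "0 \<le> K" and bump: "\<And>c b. 0 < c \<Longrightarrow>
      (\<integral>\<^sup>+t. ennreal (max 1 (c * \<bar>t - b\<bar>) powr (- (\<sigma> / 2))) \<partial>lborel) = ennreal (K / c)"
    using nn_integral_scaled_bump[of "\<sigma> / 2"] \<sigma> by auto
  obtain D where D: "0 \<le> D" and minor: "\<And>H::nat. 1 \<le> H \<Longrightarrow>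
      (14 * real H * (1 + ln (4 * real H))) powr \<sigma> \<le> D * real H powr (2 * \<sigma> - 2)"
    using minor_arc_powr_le[OF \<sigma>] by blast
  define Z where "Z = (\<Sum>q. real q powr (1 - \<sigma>))"
  have summable: "summable (\<lambda>q. real q powr (1 - \<sigma>))"
    using \<sigma> by (subst summable_real_powr_iff) auto
  have Z: "(\<Sum>q=1..n. real q powr (1 - \<sigma>)) \<le> Z" for n
    unfolding Z_def by (rule sum_le_suminf[OF summable]) auto
  have Z0: "0 \<le> Z" using Z[of 0] by simp
  define C where "C = 2 powr \<sigma> * (2 * 2 powr \<sigma> * K * Z + D) + 1"
  have C: "0 < C" unfolding C_def using K D Z0 by (intro add_nonneg_pos mult_nonneg_nonneg add_nonneg_nonneg) auto
  have "(\<integral>\<^sup>+t\<in>{0..1}. ennreal (spike_sum H t powr \<sigma>) \<partial>lborel)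
       \<le> ennreal (C * real H powr (2 * \<sigma> - 2))" if H: "1 \<le> H" for H :: nat
  proof -
    define A where "A q = (2 * (real H)\<^sup>2 / real q) powr \<sigma>" for q :: nat
    define \<Phi> where "\<Phi> q a t = max 1 ((real H)\<^sup>2 * \<bar>t - real a / real q\<bar>) powr (- (\<sigma> / 2))"
      for q a :: nat and t :: real
    define M where "M = (14 * real H * (1 + ln (4 * real H))) powr \<sigma>"
    have \<Phi>_int: "(\<integral>\<^sup>+t. ennreal (\<Phi> q a t) \<partial>lborel) = ennreal (K / (real H)\<^sup>2)" for q a
      unfolding \<Phi>_def using H by (intro bump) auto
    have [measurable]: "\<Phi> q a \<in> borel_measurable borel" for q a
      unfolding \<Phi>_def[abs_def] by measurable
    have nn: "0 \<le> A q" "0 \<le> \<Phi> q a t" "0 \<le> M" for q a t by (auto simp: A_def \<Phi>_def M_def)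
    have "(\<integral>\<^sup>+t\<in>{0..1}. ennreal (spike_sum H t powr \<sigma>) \<partial>lborel)
        \<le> (\<integral>\<^sup>+t. ennreal (2 powr \<sigma>) * (\<Sum>q=1..4 * H. \<Sum>a=0..q. ennreal (A q) * ennreal (\<Phi> q a t))
              + ennreal (2 powr \<sigma> * M) * indicator {0..1} t \<partial>lborel)"
    proof (rule nn_integral_mono)
      fix t :: real
      show "ennreal (spike_sum H t powr \<sigma>) * indicator {0..1} t
          \<le> ennreal (2 powr \<sigma>) * (\<Sum>q=1..4 * H. \<Sum>a=0..q. ennreal (A q) * ennreal (\<Phi> q a t))
              + ennreal (2 powr \<sigma> * M) * indicator {0..1} t"
      proof (cases "t \<in> {0..1}")
        case True
        have "ennreal (spike_sum H t powr \<sigma>)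
            \<le> ennreal (2 powr \<sigma> * (\<Sum>q=1..4 * H. \<Sum>a=0..q. A q * \<Phi> q a t) + 2 powr \<sigma> * M)"
          unfolding A_def \<Phi>_def M_def using \<sigma> by (intro ennreal_leI spike_sum_powr_le H True) auto
        also have "\<dots> = ennreal (2 powr \<sigma>) * (\<Sum>q=1..4 * H. \<Sum>a=0..q. ennreal (A q) * ennreal (\<Phi> q a t))
              + ennreal (2 powr \<sigma> * M)"
          using nn by (simp add: ennreal_plus ennreal_mult' sum_nonneg flip: sum_ennreal)
        finally show ?thesis using True by simp
      qed simp
    qed
    also have "\<dots> = ennreal (2 powr \<sigma>) * (\<Sum>q=1..4 * H. \<Sum>a=0..q. ennreal (A q) * (\<integral>\<^sup>+t. ennreal (\<Phi> q a t) \<partial>lborel))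
              + ennreal (2 powr \<sigma> * M)"
      by (simp add: nn_integral_add nn_integral_cmult nn_integral_sum)
    also have "\<dots> = ennreal (2 powr \<sigma> * (\<Sum>q=1..4 * H. \<Sum>a=0..q. A q * (K / (real H)\<^sup>2)) + 2 powr \<sigma> * M)"
    proof -
      have "(\<Sum>q=1..4 * H. \<Sum>a=0..q. ennreal (A q) * ennreal (K / (real H)\<^sup>2))
          = ennreal (\<Sum>q=1..4 * H. \<Sum>a=0..q. A q * (K / (real H)\<^sup>2))"
        using nn K by (subst sum_ennreal[symmetric], force intro!: sum_nonneg)+
          (intro sum.cong refl ennreal_mult[symmetric]; simp)
      then show ?thesis
        unfolding \<Phi>_int using nn K by (simp only: ennreal_plus ennreal_mult' sum_nonneg mult_nonneg_nonneg
          powr_ge_zero divide_nonneg_nonneg zero_le_power2)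
    qed
    also have "\<dots> \<le> ennreal (C * real H powr (2 * \<sigma> - 2))"
    proof (rule ennreal_leI)
      have "(\<Sum>q=1..4 * H. \<Sum>a=0..q. A q * (K / (real H)\<^sup>2))
          = (\<Sum>q=1..4 * H. (real q + 1) * A q * (K / (real H)\<^sup>2))"
        by (simp add: algebra_simps)
      also have "\<dots> \<le> (\<Sum>q=1..4 * H. 2 * 2 powr \<sigma> * K * real H powr (2 * \<sigma> - 2) * real q powr (1 - \<sigma>))"
      proof (rule sum_mono)
        fix q assume q: "q \<in> {1..4 * H}"
        have "A q * (K / (real H)\<^sup>2) = 2 powr \<sigma> * K * real H powr (2 * \<sigma> - 2) * real q powr (- \<sigma>)"
          using H q by (simp add: A_def powr_divide powr_mult powr_minus_divide powr_powr powr_diff mult_ac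
              flip: powr_numeral)
        moreover have "(real q + 1) * real q powr (- \<sigma>) \<le> 2 * real q powr (1 - \<sigma>)"
        proof -
          have "(real q + 1) * real q powr (- \<sigma>) \<le> (2 * real q powr 1) * real q powr (- \<sigma>)"
            using q by (intro mult_right_mono) auto
          also have "\<dots> = 2 * real q powr (1 - \<sigma>)"
            unfolding mult.assoc powr_add[symmetric] by simp
          finally show ?thesis .
        qed
        moreover have "(real q + 1) * A q * (K / (real H)\<^sup>2) = (real q + 1) * (A q * (K / (real H)\<^sup>2))"
          by (rule mult.assoc)
        ultimately show "(real q + 1) * A q * (K / (real H)\<^sup>2)
            \<le> 2 * 2 powr \<sigma> * K * real H powr (2 * \<sigma> - 2) * real q powr (1 - \<sigma>)"
          using mult_left_mono[of "(real q + 1) * real q powr (- \<sigma>)" "2 * real q powr (1 - \<sigma>)"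
              "2 powr \<sigma> * K * real H powr (2 * \<sigma> - 2)"] K
          by (simp add: mult_ac)
      qed
      also have "\<dots> = 2 * 2 powr \<sigma> * K * real H powr (2 * \<sigma> - 2) * (\<Sum>q=1..4 * H. real q powr (1 - \<sigma>))"
        by (simp add: sum_distrib_left)
      also have "\<dots> \<le> 2 * 2 powr \<sigma> * K * real H powr (2 * \<sigma> - 2) * Z"
        using K by (intro mult_left_mono Z) auto
      finally have major: "(\<Sum>q=1..4 * H. \<Sum>a=0..q. A q * (K / (real H)\<^sup>2))
          \<le> 2 * 2 powr \<sigma> * K * real H powr (2 * \<sigma> - 2) * Z" .
      have "2 powr \<sigma> * (\<Sum>q=1..4 * H. \<Sum>a=0..q. A q * (K / (real H)\<^sup>2)) + 2 powr \<sigma> * M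
          \<le> 2 powr \<sigma> * (2 * 2 powr \<sigma> * K * real H powr (2 * \<sigma> - 2) * Z)
            + 2 powr \<sigma> * (D * real H powr (2 * \<sigma> - 2))"
        using major minor[OF H] by (intro add_mono mult_left_mono) (auto simp: M_def)
      also have "\<dots> = (C - 1) * real H powr (2 * \<sigma> - 2)"
        by (simp add: C_def algebra_simps)
      also have "\<dots> \<le> C * real H powr (2 * \<sigma> - 2)"
        by (intro mult_right_mono) auto
      finally show "2 powr \<sigma> * (\<Sum>q=1..4 * H. \<Sum>a=0..q. A q * (K / (real H)\<^sup>2)) + 2 powr \<sigma> * M
          \<le> C * real H powr (2 * \<sigma> - 2)" .
    qed
    finally show ?thesis .
  qed
  with C show ?thesis by (intro that[of C]) auto
qed

section \<open>Detecting integer frequencies by integration\<close>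

lemma set_integral_phase:
  "(LINT t:{0..1}|lborel. phase (of_int n * t)) = (if n = 0 then 1 else 0)"
proof (cases "n = 0")
  case True
  then show ?thesis by (simp add: set_integral_const set_lebesgue_integral_def)
next
  case False
  define c where "c = 2 * of_real pi * \<i> * complex_of_int n"
  have c: "c \<noteq> 0" using False by (simp add: c_def)
  have ph: "phase (of_int n * t) = exp (c * of_real t)" for t
    by (simp add: phase_def cis_conv_exp c_def mult_ac)
  have "((\<lambda>t. exp (c * of_real t) / c) has_vector_derivative exp (c * of_real t)) (at t within {0..1})" for t
    by (rule derivative_eq_intros has_vector_derivative_real_field | simp add: c)+
  then have "(LINT t:{0..1}|lborel. exp (c * of_real t)) = exp (c * of_real 1) / c - exp (c * of_real 0) / c"
    unfolding set_lebesgue_integral_def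
    by (intro integral_FTC_Icc) (auto intro!: continuous_intros)
  also have "exp (c * of_real 1) = 1"
    using phase_of_int[of n] ph[of 1] by simp
  finally show ?thesis using False by (simp add: ph)
qed

lemma integrable_phase: "set_integrable lborel {0..1} (\<lambda>t. phase (of_int n * t))"
  by (intro borel_integrable_atLeastAtMost' continuous_intros)

text \<open>
  The condition \<open>\<nu> k \<in> I\<close> is detected by orthogonality, as the integral over \<open>t\<close> of \<open>phase (\<nu> k t)\<close>
  against the Dirichlet kernel \<open>D\<close> of \<open>I\<close>. Of the kernel only \<open>|D| \<le> card I\<close> is used. This is lossy in
  general, but the functions \<open>U\<close> below are so concentrated at fractions with small denominators that it costs
  a constant factor only, and a smooth cutoff would gain nothing.
\<close>

lemma sum_restricted_le_nn_integral:
  fixes w :: "'k \<Rightarrow> real" and \<nu> :: "'k \<Rightarrow> int" and U :: "real \<Rightarrow> real"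
  assumes U_meas [measurable]: "U \<in> borel_measurable borel"
    and B: "finite B" and I: "finite I" and w: "\<And>k. k \<in> B \<Longrightarrow> 0 \<le> w k"
    and U: "\<And>t. t \<in> {0..1} \<Longrightarrow> norm (\<Sum>k\<in>B. of_real (w k) * phase (of_int (\<nu> k) * t)) \<le> U t"
  shows "ennreal (\<Sum>k\<in>{k \<in> B. \<nu> k \<in> I}. w k) \<le> of_nat (card I) * (\<integral>\<^sup>+t\<in>{0..1}. ennreal (U t) \<partial>lborel)"
proof -
  define D where "D t = (\<Sum>m\<in>I. phase (of_int (- m) * t))" for t
  define S where "S t = (\<Sum>k\<in>B. of_real (w k) * phase (of_int (\<nu> k) * t))" for t
  have DS: "D t * S t = (\<Sum>m\<in>I. \<Sum>k\<in>B. of_real (w k) * phase (of_int (\<nu> k - m) * t))" for t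
    unfolding D_def S_def sum_product
    by (intro sum.cong refl) (simp add: phase_add[symmetric] algebra_simps)
  have int1: "set_integrable lborel {0..1} (\<lambda>t. of_real (w k) * phase (of_int (\<nu> k - m) * t))" for k m
    by (intro set_integrable_mult_right integrable_phase)
  have "(LINT t:{0..1}|lborel. D t * S t)
      = (\<Sum>m\<in>I. \<Sum>k\<in>B. of_real (w k) * (LINT t:{0..1}|lborel. phase (of_int (\<nu> k - m) * t)))"
    unfolding DS using int1 unfolding set_integrable_def set_lebesgue_integral_def scaleR_sum_right
    by (simp only: Bochner_Integration.integral_sum Bochner_Integration.integrable_sum mult_scaleR_right
        set_integral_mult_right flip: set_lebesgue_integral_def)
  also have "\<dots> = (\<Sum>k\<in>B. \<Sum>m\<in>I. if m = \<nu> k then of_real (w k) else 0)"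
    unfolding set_integral_phase by (subst sum.swap) (auto intro!: sum.cong)
  also have "\<dots> = of_real (\<Sum>k\<in>{k \<in> B. \<nu> k \<in> I}. w k)"
    using B I by (auto simp: sum.inter_filter intro!: sum.cong)
  finally have eq: "(LINT t:{0..1}|lborel. D t * S t) = of_real (\<Sum>k\<in>{k \<in> B. \<nu> k \<in> I}. w k)" .
  have "ennreal (\<Sum>k\<in>{k \<in> B. \<nu> k \<in> I}. w k) = ennreal (norm (LINT t:{0..1}|lborel. D t * S t))"
    unfolding eq norm_of_real using w by (subst abs_of_nonneg) (auto intro: sum_nonneg)
  also have "\<dots> \<le> (\<integral>\<^sup>+t. ennreal (norm (indicator {0..1} t *\<^sub>R (D t * S t))) \<partial>lborel)"
    unfolding set_lebesgue_integral_def
  proof (rule integral_norm_bound_ennreal)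
    show "integrable lborel (\<lambda>t. indicator {0..1} t *\<^sub>R (D t * S t))"
      unfolding DS using int1 by (simp add: set_integrable_def scaleR_sum_right)
  qed
  also have "\<dots> \<le> (\<integral>\<^sup>+t. of_nat (card I) * (ennreal (U t) * indicator {0..1} t) \<partial>lborel)"
  proof (rule nn_integral_mono)
    fix t :: real
    show "ennreal (norm (indicator {0..1} t *\<^sub>R (D t * S t))) \<le> of_nat (card I) * (ennreal (U t) * indicator {0..1} t)"
    proof (cases "t \<in> {0..1}")
      case True
      have "norm (D t) \<le> (\<Sum>m\<in>I. norm (phase (of_int (- m) * t)))"
        unfolding D_def by (rule norm_sum)
      then have "norm (D t) * norm (S t) \<le> real (card I) * U t"
        using U[OF True] by (intro mult_mono) (auto simp: S_def)
      then have "ennreal (norm (D t * S t)) \<le> ennreal (real (card I) * U t)"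
        by (intro ennreal_leI) (simp add: norm_mult)
      also have "\<dots> = of_nat (card I) * ennreal (U t)"
        by (simp add: ennreal_mult' ennreal_of_nat_eq_real_of_nat)
      finally show ?thesis using True by simp
    qed simp
  qed
  also have "\<dots> = of_nat (card I) * (\<integral>\<^sup>+t\<in>{0..1}. ennreal (U t) \<partial>lborel)"
    by (rule nn_integral_cmult) measurable
  finally show ?thesis .
qed

section \<open>From weak type to strong type\<close>

text \<open>
  Marcinkiewicz interpolation between weak type \<open>p0\<close> and a sup bound, by dyadic levels: at the
  height \<open>B/2\<^sup>j\<close> the weak bound contributes a multiple of \<open>(B/2\<^sup>j)\<^bsup>p - p0\<^esup>\<close>, a geometric series
  because \<open>p > p0\<close>.
\<close>

lemma weak_type_imp_strong_type:
  fixes g :: "'a \<Rightarrow> real" and p p0 B K :: real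
  assumes g [measurable]: "g \<in> borel_measurable M" and nonneg: "\<And>x. 0 \<le> g x"
    and p: "0 < p0" "p0 < p" and B: "0 < B" and K: "0 \<le> K"
    and bound: "AE x in M. g x \<le> B"
    and weak: "\<And>\<alpha>. 0 < \<alpha> \<Longrightarrow> emeasure M {x \<in> space M. \<alpha> < g x} \<le> ennreal (K / \<alpha> powr p0)"
  shows "(\<integral>\<^sup>+x. ennreal (g x powr p) \<partial>M)
           \<le> ennreal (2 powr p0 / (1 - 2 powr (p0 - p)) * K * B powr (p - p0))"
proof -
  define b where "b j = B * (1 / 2) ^ j" for j :: nat
  have b: "0 < b j" for j using B by (simp add: b_def)
  define E where "E j = {x \<in> space M. b (Suc j) < g x}" for j
  define r where "r = 2 powr (p0 - p)"
  have r: "0 < r" "r < 1" using p by (auto simp: r_def powr_less_one)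
  have [measurable]: "E j \<in> sets M" for j unfolding E_def by measurable
  have "(\<integral>\<^sup>+x. ennreal (g x powr p) \<partial>M)
      \<le> (\<integral>\<^sup>+x. (\<Sum>j. ennreal (b j powr p) * indicator (E j) x) \<partial>M)"
  proof (rule nn_integral_mono_AE)
    show "AE x in M. ennreal (g x powr p) \<le> (\<Sum>j. ennreal (b j powr p) * indicator (E j) x)"
      using bound AE_space
    proof eventually_elim
      case (elim x)
      show ?case
      proof (cases "g x = 0")
        case False
        then have gx: "0 < g x" using nonneg[of x] by linarith
        have lim: "\<exists>n. b n < g x"
        proof -
          obtain n where "(1 / 2 :: real) ^ n < g x / B"
            using real_arch_pow_inv[of "g x / B" "1 / 2"] gx B by auto
          then have "b n < g x" using B by (simp add: b_def field_simps)
          then show ?thesis ..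
        qed
        define n where "n = (LEAST n. b n < g x)"
        have n: "b n < g x" unfolding n_def using lim by (rule LeastI_ex)
        have "n \<noteq> 0"
        proof
          assume "n = 0"
          then show False using n elim by (simp add: b_def)
        qed
        then obtain j where j: "n = Suc j" by (cases n) auto
        \<comment> \<open>So \<open>b (Suc j) < g x \<le> b j\<close>: this single level already dominates.\<close>
        have "\<not> b j < g x" using not_less_Least[of j "\<lambda>n. b n < g x"] j by (simp add: n_def)
        then have "ennreal (g x powr p) \<le> ennreal (b j powr p) * indicator (E j) x"
          using n j elim p gx by (auto simp: E_def intro!: ennreal_leI powr_mono2)
        also have "\<dots> = (\<Sum>i\<in>{j}. ennreal (b i powr p) * indicator (E i) x)"
          by (simp only: sum.insert finite.emptyI empty_iff not_False_eq_True sum.empty add_0_right)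
        also have "\<dots> \<le> (\<Sum>i. ennreal (b i powr p) * indicator (E i) x)"
          by (rule sum_le_suminf) auto
        finally show ?thesis .
      qed (use p in simp)
    qed
  qed
  also have "\<dots> = (\<Sum>j. ennreal (b j powr p) * emeasure M (E j))"
    by (subst nn_integral_suminf) (auto simp: nn_integral_cmult)
  also have "\<dots> \<le> (\<Sum>j. ennreal (2 powr p0 * K * B powr (p - p0) * r ^ j))"
  proof (rule suminf_le)
    fix j
    have "ennreal (b j powr p) * emeasure M (E j) \<le> ennreal (b j powr p) * ennreal (K / b (Suc j) powr p0)"
      unfolding E_def by (intro mult_left_mono weak b) simp
    also have "\<dots> = ennreal (b j powr p * (K / b (Suc j) powr p0))"
      by (rule ennreal_mult'[symmetric]) simp
    also have "b j powr p * (K / b (Suc j) powr p0) = 2 powr p0 * K * B powr (p - p0) * r ^ j"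
    proof -
      have hp: "((1 / 2) ^ j) powr x = 2 powr (- (real j * x))" for x :: real
      proof -
        have "(1 / 2 :: real) ^ j = 2 powr (- real j)"
          by (simp add: powr_minus_divide powr_realpow power_divide)
        then show ?thesis by (simp add: powr_powr)
      qed
      have "b (Suc j) powr p0 = (b j / 2) powr p0" by (simp add: b_def)
      also have "\<dots> = b j powr p0 / 2 powr p0" by (rule powr_divide)
      finally have "b j powr p * (K / b (Suc j) powr p0) = 2 powr p0 * K * b j powr (p - p0)"
        by (simp add: powr_diff)
      also have "b j powr (p - p0) = B powr (p - p0) * 2 powr (- (real j * (p - p0)))"
        using B by (simp add: b_def powr_mult hp)
      also have "2 powr (- (real j * (p - p0))) = r ^ j"
        by (simp add: r_def powr_power algebra_simps)
      finally show ?thesis by (simp add: mult_ac)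
    qed
    finally show "ennreal (b j powr p) * emeasure M (E j) \<le> ennreal (2 powr p0 * K * B powr (p - p0) * r ^ j)" .
  qed auto
  also have "\<dots> = ennreal (\<Sum>j. 2 powr p0 * K * B powr (p - p0) * r ^ j)"
    using r K by (intro suminf_ennreal2 summable_mult summable_geometric) auto
  also have "(\<Sum>j. 2 powr p0 * K * B powr (p - p0) * r ^ j) = 2 powr p0 * K * B powr (p - p0) * (1 / (1 - r))"
    using r by (subst suminf_mult) (auto simp: suminf_geometric summable_geometric)
  finally show ?thesis by (simp add: r_def mult_ac)
qed

section \<open>Fourier analysis on the torus\<close>

lemma phase_sum: "phase (\<Sum>i\<in>A. f i) = (\<Prod>i\<in>A. phase (f i))"
  by (induction A rule: infinite_finite_induct) (auto simp: phase_add)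

lemma fourier_char_eq_phase: "fourier_char k x = phase (k \<bullet> x)"
  by (simp add: fourier_char_def phase_def cis_conv_exp mult_ac)

lemma norm_fourier_char [simp]: "norm (fourier_char k x) = 1"
  by (simp add: fourier_char_eq_phase)

lemma fourier_char_mult: "fourier_char k x * fourier_char l x = fourier_char (k + l) x"
  by (simp add: fourier_char_eq_phase phase_add inner_add_left)

lemma fourier_char_diff: "fourier_char k (y - x) = fourier_char k y * fourier_char (- k) x"
  by (simp add: fourier_char_eq_phase inner_diff_right flip: phase_add)

lemma cnj_fourier_char: "cnj (fourier_char k x) = fourier_char (- k) x"
  by (simp add: fourier_char_eq_phase cnj_phase)

lemma space_torus [simp]: "space torus = cbox 0 1"
  by (simp add: torus_def)

lemma borel_measurable_imp_torus:
  "f \<in> borel_measurable borel \<Longrightarrow> f \<in> borel_measurable torus"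
  unfolding torus_def by (intro measurable_restrict_space1 measurable_completion) simp

lemma fourier_char_measurable_borel [measurable]:
  "fourier_char k \<in> borel_measurable borel"
  unfolding fourier_char_eq_phase[abs_def]
  by (intro borel_measurable_continuous_onI continuous_intros)

lemma fourier_char_measurable [measurable]: "fourier_char k \<in> borel_measurable torus"
  by (intro borel_measurable_imp_torus) measurable

lemma one_inner_Basis: "b \<in> Basis \<Longrightarrow> (1 :: real ^ 'n) \<bullet> b = 1"
  by (auto simp: Basis_vec_def inner_axis)

lemma emeasure_torus: "emeasure (torus :: (real ^ 'n) measure) (cbox 0 1) = 1"
proof -
  have "emeasure (torus :: (real ^ 'n) measure) (cbox 0 1) = emeasure lborel (cbox 0 (1 :: real ^ 'n))"
    unfolding torus_def by (subst emeasure_restrict_space) auto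
  also have "\<dots> = 1"
    by (subst emeasure_lborel_cbox) (auto simp: one_inner_Basis)
  finally show ?thesis .
qed

interpretation torus: finite_measure torus
  by standard (simp add: emeasure_torus)

lemma integral_torus_borel:
  fixes f :: "real ^ 'n \<Rightarrow> complex"
  assumes f: "f \<in> borel_measurable borel"
  shows "(LINT x|torus. f x) = (LINT x:cbox 0 1|lborel. f x)"
proof -
  have "(LINT x|torus. f x) = (LINT x|lebesgue. indicator (cbox 0 1) x *\<^sub>R f x)"
    unfolding torus_def by (subst integral_restrict_space) auto
  also have "\<dots> = (LINT x|lborel. indicator (cbox 0 1) x *\<^sub>R f x)"
    using f by (intro integral_completion) auto
  finally show ?thesis by (simp add: set_lebesgue_integral_def)
qed

lemma int_lattice_inner_Basis:
  assumes "k \<in> int_lattice" "b \<in> Basis"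
  shows "k \<bullet> b \<in> \<int>"
  using assms by (auto simp: int_lattice_def Basis_vec_def inner_axis)

text \<open>
  The integrand is a product of functions of one coordinate each, so that Fubini reduces the claim to
  dimension one.
\<close>

lemma integral_fourier_char:
  fixes k :: "real ^ 'n"
  assumes k: "k \<in> int_lattice"
  shows "(LINT x|torus. fourier_char k x) = (if k = 0 then 1 else 0)"
proof -
  interpret P: product_sigma_finite "\<lambda>_ :: real ^ 'n. lborel :: real measure" ..
  define u where "u b t = indicator {0..1} t *\<^sub>R phase ((k \<bullet> b) * t)" for b :: "real ^ 'n" and t :: real
  define V where "V f = (\<Sum>b\<in>Basis. f b *\<^sub>R b)" for f :: "real ^ 'n \<Rightarrow> real"
  have V_meas: "V \<in> measurable (\<Pi>\<^sub>M b\<in>Basis. lborel) borel"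
    unfolding V_def[abs_def] by measurable
  have uV: "indicator (cbox 0 1) (V f) *\<^sub>R fourier_char k (V f) = (\<Prod>b\<in>Basis. u b (f b))"
    for f
  proof -
    have Vb: "V f \<bullet> b = f b" if "b \<in> Basis" for b
      using that by (simp add: V_def inner_sum_left inner_Basis if_distrib cong: if_cong)
    have "indicator (cbox 0 1) (V f) = (\<Prod>b\<in>Basis. indicator {0..1} (f b) :: real)"
    proof (cases "V f \<in> cbox 0 1")
      case True
      then have "f b \<in> {0..1}" if "b \<in> Basis" for b
        using that by (auto simp: mem_box Vb one_inner_Basis)
      then show ?thesis using True by simp
    next
      case False
      then obtain b where "b \<in> Basis" "f b \<notin> {0..1}"
        by (auto simp: mem_box Vb one_inner_Basis)
      then have "(\<Prod>b\<in>Basis. indicator {0..1} (f b) :: real) = 0"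
        by (intro prod_zero) (auto intro: bexI[of _ b])
      then show ?thesis using False by simp
    qed
    moreover have "fourier_char k (V f) = (\<Prod>b\<in>Basis. phase ((k \<bullet> b) * f b))"
      unfolding fourier_char_eq_phase V_def inner_sum_right phase_sum[symmetric]
      by (simp add: mult.commute)
    ultimately show ?thesis
      by (simp add: u_def scaleR_conv_of_real prod.distrib)
  qed
  have "(LINT x|torus. fourier_char k x) = (LINT x|lborel. indicator (cbox 0 1) x *\<^sub>R fourier_char k x)"
    by (subst integral_torus_borel) (auto simp: set_lebesgue_integral_def)
  also have "\<dots> = (LINT f|(\<Pi>\<^sub>M b\<in>Basis. lborel). indicator (cbox 0 1) (V f) *\<^sub>R fourier_char k (V f))"
    unfolding lborel_eq[where 'a = "real ^ 'n"] V_def[symmetric, abs_def]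
    by (subst integral_distr) (use V_meas in \<open>auto simp: V_def[abs_def]\<close>)
  also have "\<dots> = (LINT f|(\<Pi>\<^sub>M b\<in>Basis. lborel). (\<Prod>b\<in>Basis. u b (f b)))"
    by (simp add: uV)
  also have "\<dots> = (\<Prod>b\<in>Basis. LINT t|lborel. u b t)"
  proof (rule P.product_integral_prod)
    show "integrable lborel (u b)" if "b \<in> Basis" for b
      using int_lattice_inner_Basis[OF k that] integrable_phase
      by (auto simp: u_def[abs_def] set_integrable_def elim!: Ints_cases)
  qed auto
  also have "\<dots> = (\<Prod>b\<in>Basis. if k \<bullet> b = 0 then 1 else 0)"
  proof (rule prod.cong[OF refl])
    fix b :: "real ^ 'n" assume "b \<in> Basis"
    then obtain n where n: "k \<bullet> b = of_int n"
      using int_lattice_inner_Basis[OF k] by (auto elim: Ints_cases)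
    show "(LINT t|lborel. u b t) = (if k \<bullet> b = 0 then 1 else 0)"
      using set_integral_phase[of n] by (simp add: u_def set_lebesgue_integral_def n)
  qed
  also have "\<dots> = (if k = 0 then 1 else 0)"
    using euclidean_all_zero_iff[of k] by (auto intro!: prod_zero)
  finally show ?thesis .
qed

lemma int_lattice_diff: "k \<in> int_lattice \<Longrightarrow> l \<in> int_lattice \<Longrightarrow> k - l \<in> int_lattice"
  by (simp add: int_lattice_def)

lemma integrable_of_square_integrable:
  fixes g :: "real ^ 'n \<Rightarrow> complex"
  assumes [measurable]: "g \<in> borel_measurable torus"
    and "integrable torus (\<lambda>x. (norm (g x))\<^sup>2)"
  shows "integrable torus g"
proof (rule Bochner_Integration.integrable_bound)
  show "integrable torus (\<lambda>x. 1 + (norm (g x))\<^sup>2)"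
    using assms by simp
  show "AE x in torus. norm (g x) \<le> norm (1 + (norm (g x))\<^sup>2)"
  proof (rule AE_I2)
    fix x
    have "0 \<le> (norm (g x) - 1)\<^sup>2" by simp
    then have "2 * norm (g x) \<le> 1 + (norm (g x))\<^sup>2"
      by (simp add: power2_diff)
    then show "norm (g x) \<le> norm (1 + (norm (g x))\<^sup>2)"
      using norm_ge_zero[of "g x"] by (simp del: norm_ge_zero)
  qed
qed measurable

lemma integrable_fourier_char_mult:
  assumes "integrable torus g"
  shows "integrable torus (\<lambda>x. fourier_char k x * g x)"
proof (rule Bochner_Integration.integrable_bound[OF assms])
  have [measurable]: "g \<in> borel_measurable torus" using assms by auto
  show "(\<lambda>x. fourier_char k x * g x) \<in> borel_measurable torus" by measurable
qed (simp add: norm_mult)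

lemma integrable_fourier_char: "integrable torus (fourier_char k)"
  using integrable_fourier_char_mult[of "\<lambda>_. 1" k] by simp

lemma cnj_fourier_coeff:
  "cnj (fourier_coeff g k) = (LINT x|torus. fourier_char k x * cnj (g x))"
  unfolding fourier_coeff_def
  by (simp add: cnj_fourier_char flip: Bochner_Integration.integral_cnj)

lemma bessel_inequality:
  fixes g :: "real ^ 'n \<Rightarrow> complex"
  assumes g [measurable]: "g \<in> borel_measurable torus"
    and g2: "integrable torus (\<lambda>x. (norm (g x))\<^sup>2)"
    and S: "S \<subseteq> int_lattice" "finite S"
  shows "(\<Sum>k\<in>S. (norm (fourier_coeff g k))\<^sup>2) \<le> (LINT x|torus. (norm (g x))\<^sup>2)"
proof -
  define c where "c = fourier_coeff g"
  define P where "P x = (\<Sum>k\<in>S. c k * fourier_char k x)" for x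
  have gi: "integrable torus g"
    by (rule integrable_of_square_integrable[OF g g2])
  have gi': "integrable torus (\<lambda>x. cnj (g x))"
    using gi by simp
  note ints = integrable_fourier_char_mult[OF gi] integrable_fourier_char_mult[OF gi'] integrable_fourier_char
  have expand: "of_real ((norm (g x - P x))\<^sup>2) =
      of_real ((norm (g x))\<^sup>2) - (\<Sum>k\<in>S. cnj (c k) * (fourier_char (- k) x * g x))
      - (\<Sum>k\<in>S. c k * (fourier_char k x * cnj (g x)))
      + (\<Sum>k\<in>S. \<Sum>l\<in>S. c k * cnj (c l) * fourier_char (k - l) x)" for x
  proof -
    have PP: "P x * cnj (P x) = (\<Sum>k\<in>S. \<Sum>l\<in>S. c k * cnj (c l) * fourier_char (k - l) x)"
      unfolding P_def cnj_sum sum_product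
      by (intro sum.cong refl) (simp add: cnj_fourier_char fourier_char_mult[symmetric] diff_conv_add_uminus
          del: add_uminus_conv_diff)
    have "of_real ((norm (g x - P x))\<^sup>2) = (g x - P x) * cnj (g x - P x)"
      by (rule complex_norm_square)
    also have "\<dots> = g x * cnj (g x) - cnj (P x) * g x - P x * cnj (g x) + P x * cnj (P x)"
      by (simp add: algebra_simps)
    also have "g x * cnj (g x) = of_real ((norm (g x))\<^sup>2)"
      by (rule complex_norm_square[symmetric])
    also have "cnj (P x) * g x = (\<Sum>k\<in>S. cnj (c k) * (fourier_char (- k) x * g x))"
      by (simp add: P_def sum_distrib_left sum_distrib_right cnj_fourier_char mult_ac)
    also have "P x * cnj (g x) = (\<Sum>k\<in>S. c k * (fourier_char k x * cnj (g x)))"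
      by (simp add: P_def sum_distrib_left sum_distrib_right mult_ac)
    finally show ?thesis unfolding PP .
  qed
  have "of_real (LINT x|torus. (norm (g x - P x))\<^sup>2) = (LINT x|torus. of_real ((norm (g x - P x))\<^sup>2) :: complex)"
    by (rule integral_complex_of_real[symmetric])
  also have "\<dots> = of_real (LINT x|torus. (norm (g x))\<^sup>2)
      - (\<Sum>k\<in>S. cnj (c k) * (LINT x|torus. fourier_char (- k) x * g x))
      - (\<Sum>k\<in>S. c k * (LINT x|torus. fourier_char k x * cnj (g x)))
      + (\<Sum>k\<in>S. \<Sum>l\<in>S. c k * cnj (c l) * (LINT x|torus. fourier_char (k - l) x))"
  proof -
    have 0: "integrable torus (\<lambda>x. complex_of_real ((norm (g x))\<^sup>2))"
      using g2 by (rule integrable_of_real)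
    have 1: "integrable torus (\<lambda>x. \<Sum>k\<in>S. cnj (c k) * (fourier_char (- k) x * g x))"
      "integrable torus (\<lambda>x. \<Sum>k\<in>S. c k * (fourier_char k x * cnj (g x)))"
      "integrable torus (\<lambda>x. \<Sum>k\<in>S. \<Sum>l\<in>S. c k * cnj (c l) * fourier_char (k - l) x)"
      by (intro Bochner_Integration.integrable_sum integrable_mult_right ints)+
    have 2: "(LINT x|torus. (\<Sum>k\<in>S. cnj (c k) * (fourier_char (- k) x * g x)))
        = (\<Sum>k\<in>S. cnj (c k) * (LINT x|torus. fourier_char (- k) x * g x))"
      "(LINT x|torus. (\<Sum>k\<in>S. c k * (fourier_char k x * cnj (g x))))
        = (\<Sum>k\<in>S. c k * (LINT x|torus. fourier_char k x * cnj (g x)))"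
      "(LINT x|torus. (\<Sum>k\<in>S. \<Sum>l\<in>S. c k * cnj (c l) * fourier_char (k - l) x))
        = (\<Sum>k\<in>S. \<Sum>l\<in>S. c k * cnj (c l) * (LINT x|torus. fourier_char (k - l) x))"
      by (simp_all only: Bochner_Integration.integral_sum Bochner_Integration.integrable_sum
          integrable_mult_right ints integral_mult_right_zero)
    show ?thesis
      unfolding expand 2[symmetric] integral_complex_of_real[symmetric]
      by (simp only: Bochner_Integration.integral_add Bochner_Integration.integral_diff
          Bochner_Integration.integrable_diff 0 1)
  qed
  also have "(\<Sum>k\<in>S. cnj (c k) * (LINT x|torus. fourier_char (- k) x * g x)) = (\<Sum>k\<in>S. of_real ((norm (c k))\<^sup>2))"
    by (intro sum.cong refl) (simp only: c_def fourier_coeff_def complex_norm_square mult.commute)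
  also have "(\<Sum>k\<in>S. c k * (LINT x|torus. fourier_char k x * cnj (g x))) = (\<Sum>k\<in>S. of_real ((norm (c k))\<^sup>2))"
    by (intro sum.cong refl) (simp only: c_def cnj_fourier_coeff[symmetric] complex_norm_square)
  also have "(\<Sum>k\<in>S. \<Sum>l\<in>S. c k * cnj (c l) * (LINT x|torus. fourier_char (k - l) x))
      = (\<Sum>k\<in>S. \<Sum>l\<in>S. if l = k then c k * cnj (c l) else 0)"
  proof (intro sum.cong refl)
    fix k l assume "k \<in> S" "l \<in> S"
    then have "k - l \<in> int_lattice" using S(1) by (auto intro: int_lattice_diff)
    then show "c k * cnj (c l) * (LINT x|torus. fourier_char (k - l) x) = (if l = k then c k * cnj (c l) else 0)"
      by (simp only: integral_fourier_char) auto
  qed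
  also have "\<dots> = (\<Sum>k\<in>S. of_real ((norm (c k))\<^sup>2))"
    using S(2) by (simp add: complex_norm_square del: of_real_power)
  finally have "complex_of_real (LINT x|torus. (norm (g x - P x))\<^sup>2)
      = of_real ((LINT x|torus. (norm (g x))\<^sup>2) - (\<Sum>k\<in>S. (norm (c k))\<^sup>2))"
    by simp
  then have "(LINT x|torus. (norm (g x - P x))\<^sup>2)
      = (LINT x|torus. (norm (g x))\<^sup>2) - (\<Sum>k\<in>S. (norm (c k))\<^sup>2)"
    by (simp only: of_real_eq_iff)
  moreover have "0 \<le> (LINT x|torus. (norm (g x - P x))\<^sup>2)" by simp
  ultimately show ?thesis by (simp add: c_def)
qed

text \<open>
  This lemma and the next bound the quadratic form of a Fourier multiplier \<open>v\<close>. They are the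
  endpoints \<open>L\<^sup>2 \<rightarrow> L\<^sup>2\<close> and \<open>L\<^sup>1 \<rightarrow> L\<^sup>\<infinity>\<close> that interpolation theory would ask for, stated only for the form
  \<open>\<langle>Tg, g\<rangle>\<close>.
\<close>

lemma norm_multiplier_form_le_L2:
  fixes g :: "real ^ 'n \<Rightarrow> complex"
  assumes g: "g \<in> borel_measurable torus" "integrable torus (\<lambda>x. (norm (g x))\<^sup>2)"
    and S: "S \<subseteq> int_lattice" "finite S" and v: "\<And>k. k \<in> S \<Longrightarrow> norm (v k :: complex) \<le> 1"
  shows "norm (\<Sum>k\<in>S. of_real ((norm (fourier_coeff g k))\<^sup>2) * v k) \<le> (LINT x|torus. (norm (g x))\<^sup>2)"
proof -
  have "norm (\<Sum>k\<in>S. of_real ((norm (fourier_coeff g k))\<^sup>2) * v k) \<le> (\<Sum>k\<in>S. (norm (fourier_coeff g k))\<^sup>2)"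
    using v by (intro sum_norm_le) (simp add: norm_mult mult_left_le norm_power)
  also have "\<dots> \<le> (LINT x|torus. (norm (g x))\<^sup>2)"
    by (rule bessel_inequality[OF g S])
  finally show ?thesis .
qed

lemma norm_multiplier_form_le_L1:
  fixes g :: "real ^ 'n \<Rightarrow> complex"
  assumes g: "integrable torus g"
    and W: "\<And>z. norm (\<Sum>k\<in>S. v k * fourier_char k z) \<le> W"
  shows "norm (\<Sum>k\<in>S. of_real ((norm (fourier_coeff g k))\<^sup>2) * v k) \<le> W * (LINT x|torus. norm (g x))\<^sup>2"
proof -
  define c where "c = fourier_coeff g"
  \<comment> \<open>The form is the integral of \<open>g\<close> against \<open>h\<close>, and \<open>h\<close> is a convolution of \<open>cnj g\<close> with the kernel.\<close>
  define h where "h x = (\<Sum>k\<in>S. v k * cnj (c k) * fourier_char (- k) x)" for x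
  have gi': "integrable torus (\<lambda>x. cnj (g x))"
    using g by simp
  have ng: "integrable torus (\<lambda>x. norm (g x))" using g by (rule integrable_norm)
  have h_le: "norm (h x) \<le> W * (LINT y|torus. norm (g y))" for x
  proof -
    have "h x = (\<Sum>k\<in>S. v k * fourier_char (- k) x * (LINT y|torus. fourier_char k y * cnj (g y)))"
      by (simp add: h_def c_def cnj_fourier_coeff mult_ac)
    also have "\<dots> = (LINT y|torus. (\<Sum>k\<in>S. v k * fourier_char (- k) x * (fourier_char k y * cnj (g y))))"
      using integrable_fourier_char_mult[OF gi'] by (simp add: Bochner_Integration.integral_sum)
    also have "norm \<dots> \<le> (LINT y|torus. W * norm (g y))"
    proof (rule Bochner_Integration.integral_norm_bound_integral)
      show "integrable torus (\<lambda>y. \<Sum>k\<in>S. v k * fourier_char (- k) x * (fourier_char k y * cnj (g y)))"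
        by (intro Bochner_Integration.integrable_sum integrable_mult_right integrable_fourier_char_mult gi')
      show "integrable torus (\<lambda>y. W * norm (g y))" using ng by simp
      fix y
      have "(\<Sum>k\<in>S. v k * fourier_char (- k) x * (fourier_char k y * cnj (g y)))
          = (\<Sum>k\<in>S. v k * fourier_char k (y - x)) * cnj (g y)"
        by (simp add: sum_distrib_left sum_distrib_right fourier_char_diff mult_ac)
      then show "norm (\<Sum>k\<in>S. v k * fourier_char (- k) x * (fourier_char k y * cnj (g y))) \<le> W * norm (g y)"
        by (simp add: norm_mult mult_right_mono W)
    qed
    finally show ?thesis by simp
  qed
  have "(\<Sum>k\<in>S. of_real ((norm (c k))\<^sup>2) * v k)
      = (\<Sum>k\<in>S. v k * cnj (c k) * (LINT x|torus. fourier_char (- k) x * g x))"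
    by (intro sum.cong refl) (simp only: complex_norm_square c_def fourier_coeff_def mult_ac)
  also have "\<dots> = (LINT x|torus. (\<Sum>k\<in>S. v k * cnj (c k) * (fourier_char (- k) x * g x)))"
    using integrable_fourier_char_mult[OF g] by (simp add: Bochner_Integration.integral_sum)
  also have "norm \<dots> \<le> (LINT x|torus. W * (LINT y|torus. norm (g y)) * norm (g x))"
  proof (rule Bochner_Integration.integral_norm_bound_integral)
    show "integrable torus (\<lambda>x. \<Sum>k\<in>S. v k * cnj (c k) * (fourier_char (- k) x * g x))"
      by (intro Bochner_Integration.integrable_sum integrable_mult_right integrable_fourier_char_mult g)
    show "integrable torus (\<lambda>x. W * (LINT y|torus. norm (g y)) * norm (g x))" using ng by simp
    fix x
    have "(\<Sum>k\<in>S. v k * cnj (c k) * (fourier_char (- k) x * g x)) = h x * g x"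
      by (simp add: h_def sum_distrib_left sum_distrib_right mult_ac)
    then show "norm (\<Sum>k\<in>S. v k * cnj (c k) * (fourier_char (- k) x * g x))
        \<le> W * (LINT y|torus. norm (g y)) * norm (g x)"
      using h_le[of x] by (simp add: norm_mult mult_right_mono)
  qed
  finally show ?thesis by (simp add: c_def power2_eq_square mult_ac)
qed

section \<open>The Schroedinger kernel and the energy in an annulus\<close>

definition int_box :: "nat \<Rightarrow> (real ^ 'n) set"
  where "int_box R = {k \<in> int_lattice. \<forall>i. \<bar>k $ i\<bar> \<le> real R}"

definition int_vec :: "('n \<Rightarrow> int) \<Rightarrow> real ^ 'n"
  where "int_vec g = (\<chi> i. of_int (g i))"

lemma int_box_eq: "(int_box R :: (real ^ 'n) set) = int_vec ` (\<Pi>\<^sub>E i\<in>UNIV. {- int R..int R})"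
proof (intro equalityI subsetI)
  fix k :: "real ^ 'n" assume "k \<in> int_box R"
  then have k: "k $ i \<in> \<int>" "\<bar>k $ i\<bar> \<le> real R" for i
    by (auto simp: int_box_def int_lattice_def)
  have fl: "of_int \<lfloor>k $ i\<rfloor> = k $ i" for i using k(1) by simp
  have "\<lfloor>k $ i\<rfloor> \<in> {- int R..int R}" for i
  proof -
    have "\<bar>real_of_int \<lfloor>k $ i\<rfloor>\<bar> \<le> real R" using k(2) by (simp only: fl)
    then show ?thesis by simp linarith
  qed
  then show "k \<in> int_vec ` (\<Pi>\<^sub>E i\<in>UNIV. {- int R..int R})"
    by (intro image_eqI[of _ _ "\<lambda>i. \<lfloor>k $ i\<rfloor>"]) (auto simp: int_vec_def vec_eq_iff fl)
next
  fix k :: "real ^ 'n" assume "k \<in> int_vec ` (\<Pi>\<^sub>E i\<in>UNIV. {- int R..int R})"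
  then obtain g where g: "k = int_vec g" "\<And>i. g i \<in> {- int R..int R}" by (auto simp: PiE_iff)
  have "\<bar>real_of_int (g i)\<bar> \<le> real R" for i using g(2)[of i] by simp linarith
  then show "k \<in> int_box R" by (simp add: int_box_def int_lattice_def int_vec_def g(1))
qed

lemma finite_int_box: "finite (int_box R :: (real ^ 'n) set)"
  unfolding int_box_eq by (intro finite_imageI finite_PiE) auto

lemma int_box_subset: "int_box R \<subseteq> int_lattice"
  by (auto simp: int_box_def)

lemma inj_int_vec: "inj int_vec"
  by (rule injI) (auto simp: int_vec_def vec_eq_iff fun_eq_iff)

lemma norm_int_vec_squared: "(norm (int_vec g))\<^sup>2 = of_int (\<Sum>i\<in>UNIV. g i * g i)"
  by (simp add: power2_norm_eq_inner inner_vec_def int_vec_def)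

text \<open>
  On the lattice \<open>|k|\<^sup>2\<close> is an integer, and the floor only serves to give it the type of one.
\<close>

definition sq_norm :: "real ^ 'n \<Rightarrow> int"
  where "sq_norm k = \<lfloor>(norm k)\<^sup>2\<rfloor>"

lemma sq_norm_int_vec: "sq_norm (int_vec g) = (\<Sum>i\<in>UNIV. g i * g i)"
  by (simp add: sq_norm_def norm_int_vec_squared del: of_int_sum)

lemma sq_norm_eq:
  assumes "k \<in> int_box R"
  shows "of_int (sq_norm k) = (norm k)\<^sup>2"
proof -
  obtain g where "k = int_vec g" using assms by (auto simp: int_box_eq)
  then show ?thesis by (simp add: sq_norm_int_vec norm_int_vec_squared)
qed

text \<open>
  On a box the phase \<open>|k|\<^sup>2t + k\<cdot>z\<close> separates, and the kernel of the Schroedinger propagator is a product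
  of one-dimensional quadratic sums.
\<close>

lemma norm_schroedinger_kernel_le:
  fixes z :: "real ^ 'n"
  shows "norm (\<Sum>k\<in>int_box R. phase (of_int (sq_norm k) * t) * fourier_char k z)
           \<le> (3 * spike_sum (4 * R + 2) t) powr (real CARD('n) / 2)"
proof -
  define G where "G = 3 * spike_sum (4 * R + 2) t"
  define u where "u i j = phase (of_int (j * j) * t + of_int j * z $ i)" for i :: 'n and j :: int
  have G: "0 \<le> G" by (simp add: G_def)
  have term_eq: "phase (of_int (sq_norm (int_vec g)) * t) * fourier_char (int_vec g) z = (\<Prod>i\<in>UNIV. u i (g i))" for g
  proof -
    have "of_int (sq_norm (int_vec g)) * t + int_vec g \<bullet> z = (\<Sum>i\<in>UNIV. of_int (g i * g i) * t + of_int (g i) * z $ i)"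
      by (simp add: sq_norm_int_vec sum.distrib sum_distrib_right inner_vec_def) (simp add: int_vec_def)
    then show ?thesis
      by (simp only: fourier_char_eq_phase phase_add[symmetric] phase_sum u_def)
  qed
  have "(\<Sum>k\<in>int_box R. phase (of_int (sq_norm k) * t) * fourier_char k z)
      = (\<Sum>g\<in>(\<Pi>\<^sub>E i\<in>UNIV. {- int R..int R}). \<Prod>i\<in>UNIV. u i (g i))"
    unfolding int_box_eq by (subst sum.reindex) (auto intro: inj_on_subset[OF inj_int_vec] simp: term_eq)
  also have "\<dots> = (\<Prod>i\<in>UNIV. \<Sum>j\<in>{- int R..int R}. u i j)"
    by (rule prod_sum_PiE[symmetric]) auto
  also have "norm \<dots> = (\<Prod>i\<in>UNIV. norm (\<Sum>j\<in>{- int R..int R}. u i j))"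
    by (rule prod_norm[symmetric])
  also have "\<dots> \<le> (\<Prod>i\<in>(UNIV :: 'n set). sqrt G)"
  proof (rule prod_mono, rule conjI)
    fix i
    have "(norm (\<Sum>j\<in>{- int R..int R}. u i j))\<^sup>2 \<le> G"
      using norm_quadratic_sum_le[where R = R and t = t and z = "z $ i"] by (simp add: u_def G_def)
    then show "norm (\<Sum>j\<in>{- int R..int R}. u i j) \<le> sqrt G"
      by (rule real_le_rsqrt)
  qed simp
  also have "\<dots> = G powr (real CARD('n) / 2)"
    using G by (simp add: powr_half_sqrt[symmetric] powr_powr powr_realpow' flip: powr_realpow')
  finally show ?thesis by (simp add: G_def)
qed

text \<open>
  For functions dominated by an indicator, interpolating between the two endpoint bounds is just taking
  a weighted geometric mean of two numbers. This replaces the Riesz-Thorin theorem.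
\<close>

lemma powr_interpolate:
  fixes x W \<mu> \<theta> :: real
  assumes "0 \<le> x" "x \<le> W * \<mu>\<^sup>2" "x \<le> \<mu>" "0 \<le> W" "0 < \<mu>" "0 < \<theta>" "\<theta> \<le> 1"
  shows "x \<le> W powr \<theta> * \<mu> powr (1 + \<theta>)"
proof (cases "x = 0")
  case False
  then have x: "0 < x" using assms by simp
  have "x = x powr \<theta> * x powr (1 - \<theta>)"
    using x by (simp flip: powr_add)
  also have "\<dots> \<le> (W * \<mu>\<^sup>2) powr \<theta> * \<mu> powr (1 - \<theta>)"
    using assms x by (intro mult_mono powr_mono2) auto
  also have "\<dots> = W powr \<theta> * (\<mu> powr (2 * \<theta>) * \<mu> powr (1 - \<theta>))"
    using assms by (simp add: powr_mult powr_powr flip: powr_numeral)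
  also have "\<mu> powr (2 * \<theta>) * \<mu> powr (1 - \<theta>) = \<mu> powr (1 + \<theta>)"
    by (simp add: add.commute flip: powr_add)
  finally show ?thesis .
qed simp

text \<open>
  Membership in the annulus depends on the integer \<open>|k|\<^sup>2\<close> only. The box is there to make sums over all
  frequencies finite.
\<close>

lemma annulus_eq_box_shell:
  fixes N \<delta> :: real
  assumes N: "1 \<le> N" and \<delta>: "0 \<le> \<delta>" "\<delta> \<le> 1" and R: "N + 1 / 2 \<le> real R"
  shows "int_lattice \<inter> annulus N \<delta>
    = {k \<in> int_box R :: (real ^ 'n) set. sq_norm k \<in> {\<lceil>(N - \<delta> / 2)\<^sup>2\<rceil>..\<lfloor>(N + \<delta> / 2)\<^sup>2\<rfloor>}}"
proof -
  have iff: "k \<in> annulus N \<delta> \<longleftrightarrow> sq_norm k \<in> {\<lceil>(N - \<delta> / 2)\<^sup>2\<rceil>..\<lfloor>(N + \<delta> / 2)\<^sup>2\<rfloor>}" 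
    if "k \<in> int_box R" for k :: "real ^ 'n"
  proof -
    have "k \<in> annulus N \<delta> \<longleftrightarrow> N - \<delta> / 2 \<le> norm k \<and> norm k \<le> N + \<delta> / 2"
      unfolding annulus_def mem_Collect_eq abs_le_iff by auto
    also have "\<dots> \<longleftrightarrow> (N - \<delta> / 2)\<^sup>2 \<le> (norm k)\<^sup>2 \<and> (norm k)\<^sup>2 \<le> (N + \<delta> / 2)\<^sup>2"
      using N \<delta> by (simp add: power_mono_iff)
    also have "\<dots> \<longleftrightarrow> sq_norm k \<in> {\<lceil>(N - \<delta> / 2)\<^sup>2\<rceil>..\<lfloor>(N + \<delta> / 2)\<^sup>2\<rfloor>}"
      unfolding sq_norm_eq[OF that, symmetric] by (simp add: ceiling_le_iff le_floor_iff)
    finally show ?thesis .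
  qed
  have "k \<in> int_box R" if "k \<in> int_lattice \<inter> annulus N \<delta>" for k :: "real ^ 'n"
  proof -
    have "\<bar>norm k - N\<bar> \<le> \<delta> / 2" using that by (simp add: annulus_def)
    then have "norm k \<le> real R" using R \<delta> by linarith
    then have "\<bar>k $ i\<bar> \<le> real R" for i
      using component_le_norm_cart[of k i] by linarith
    then show ?thesis using that by (simp add: int_box_def)
  qed
  then show ?thesis using iff int_box_subset by blast
qed

text \<open>
  The interval for \<open>|k|\<^sup>2\<close> has length \<open>2N\<delta>\<close>. The lower bound on \<open>\<delta>\<close> absorbs the extra \<open>1\<close> of
  the count into \<open>N\<delta>\<close>.
\<close>

lemma card_shell_le:
  fixes N \<delta> c :: real
  assumes "1 \<le> N" "0 < c" "c / N \<le> \<delta>"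
  shows "real (card {\<lceil>(N - \<delta> / 2)\<^sup>2\<rceil>..\<lfloor>(N + \<delta> / 2)\<^sup>2\<rfloor>}) \<le> (2 + 1 / c) * (N * \<delta>)"
proof -
  have d: "c \<le> N * \<delta>" using assms by (simp add: field_simps)
  have "real (card {\<lceil>(N - \<delta> / 2)\<^sup>2\<rceil>..\<lfloor>(N + \<delta> / 2)\<^sup>2\<rfloor>}) \<le> max 0 ((N + \<delta> / 2)\<^sup>2 - (N - \<delta> / 2)\<^sup>2 + 1)"
    by (simp add: of_nat_nat) linarith
  also have "(N + \<delta> / 2)\<^sup>2 - (N - \<delta> / 2)\<^sup>2 = 2 * (N * \<delta>)"
    by (simp add: power2_eq_square algebra_simps)
  also have "max 0 (2 * (N * \<delta>) + 1) = 2 * (N * \<delta>) + 1" using d assms by simp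
  also have "\<dots> \<le> 2 * (N * \<delta>) + (1 / c) * (N * \<delta>)"
    using d assms by (simp add: field_simps)
  finally show ?thesis by (simp add: ring_distribs)
qed

text \<open>
  The energy in the annulus is an average over \<open>t\<close> of quadratic forms of the Schroedinger propagator. At each
  time the form is at most \<open>W(t)\<^bsup>\<theta>\<^esup> \<mu>\<^bsup>1 + \<theta>\<^esup>\<close>, with \<open>W(t)\<close> the bound for the kernel and \<open>\<mu>\<close> the measure of
  \<open>E\<close>, and \<open>W(t)\<^bsup>\<theta>\<^esup>\<close> is a constant times the power \<open>\<sigma> = d\<theta>/2\<close> of a spike sum, whose moments are known as soon as
  \<open>\<sigma> > 2\<close>.
\<close>

lemma restricted_fourier_energy_le:
  fixes \<theta> c :: real
  assumes \<theta>: "0 < \<theta>" "\<theta> \<le> 1" "4 < real CARD('n) * \<theta>" and c: "0 < c"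
  obtains C where "0 < C"
    "\<And>N \<delta> (g :: real ^ 'n \<Rightarrow> complex) E. \<lbrakk>1 \<le> N; c / N \<le> \<delta>; \<delta> \<le> 1; g \<in> borel_measurable torus; E \<in> sets torus;
       0 < measure torus E; \<And>x. norm (g x) \<le> indicator E x\<rbrakk>
     \<Longrightarrow> (\<Sum>k\<in>int_lattice \<inter> annulus N \<delta>. (norm (fourier_coeff g k))\<^sup>2)
        \<le> C * \<delta> * N powr (real CARD('n) * \<theta> - 1) * measure torus E powr (1 + \<theta>)"
proof -
  define d where "d = real CARD('n)"
  define \<sigma> where "\<sigma> = d * \<theta> / 2"
  have \<sigma>: "2 < \<sigma>" using \<theta> by (simp add: \<sigma>_def d_def)
  obtain C0 where C0: "0 < C0" and moment: "\<And>H::nat. 1 \<le> H \<Longrightarrow>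
      (\<integral>\<^sup>+t\<in>{0..1}. ennreal (spike_sum H t powr \<sigma>) \<partial>lborel) \<le> ennreal (C0 * real H powr (2 * \<sigma> - 2))"
    using spike_sum_moment_le[OF \<sigma>] by blast
  define C where "C = (2 + 1 / c) * (3 powr \<sigma> * (C0 * 14 powr (2 * \<sigma> - 2)))"
  have C: "0 < C" using C0 c by (simp add: C_def add_pos_pos)
  have "(\<Sum>k\<in>int_lattice \<inter> annulus N \<delta>. (norm (fourier_coeff g k))\<^sup>2)
        \<le> C * \<delta> * N powr (d * \<theta> - 1) * measure torus E powr (1 + \<theta>)"
    if N: "1 \<le> N" and \<delta>: "c / N \<le> \<delta>" "\<delta> \<le> 1" and g [measurable]: "g \<in> borel_measurable torus"
      and E [measurable]: "E \<in> sets torus" and pos: "0 < measure torus E"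
      and gE: "\<And>x. norm (g x) \<le> indicator E x"
    for N \<delta> and g :: "real ^ 'n \<Rightarrow> complex" and E
  proof -
    have \<delta>0: "0 < \<delta>" using \<delta> c N by (intro less_le_trans[OF _ \<delta>(1)]) auto
    define \<mu> where "\<mu> = measure torus E"
    define R where "R = nat \<lceil>N\<rceil> + 1"
    have R: "N + 1 / 2 \<le> real R" "real R \<le> N + 2"
      using N unfolding R_def by linarith+
    define H where "H = 4 * R + 2"
    \<comment> \<open>The constant comes from \<open>4 (N + 2) + 2 \<le> 14 N\<close>.\<close>
    have H: "1 \<le> H" "real H \<le> 14 * N" using R N by (auto simp: H_def)
    define I where "I = {\<lceil>(N - \<delta> / 2)\<^sup>2\<rceil>..\<lfloor>(N + \<delta> / 2)\<^sup>2\<rfloor>}"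
    have Esub: "E \<inter> cbox 0 1 = E"
      using sets.sets_into_space[OF E] by auto
    have iE: "integrable torus (indicator E :: _ \<Rightarrow> real)"
      using E by (intro integrable_real_indicator) (auto simp: torus.emeasure_eq_measure)
    have gi: "integrable torus g"
      by (rule Bochner_Integration.integrable_bound[OF iE]) (use gE in auto)
    have g1: "(LINT x|torus. norm (g x)) \<le> \<mu>"
    proof -
      have "(LINT x|torus. norm (g x)) \<le> (LINT x|torus. indicator E x)"
        using gE gi iE by (intro integral_mono) auto
      then show ?thesis by (simp add: \<mu>_def Esub)
    qed
    have sq: "(norm (g x))\<^sup>2 \<le> indicator E x" for x
      using gE[of x] power_le_one[of "norm (g x)" 2] by (auto simp: indicator_def split: if_splits)
    have g2i: "integrable torus (\<lambda>x. (norm (g x))\<^sup>2)"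
      by (rule Bochner_Integration.integrable_bound[OF iE]) (use sq in auto)
    have g2: "(LINT x|torus. (norm (g x))\<^sup>2) \<le> \<mu>"
    proof -
      have "(LINT x|torus. (norm (g x))\<^sup>2) \<le> (LINT x|torus. indicator E x)"
        using sq g2i iE by (intro integral_mono) auto
      then show ?thesis by (simp add: \<mu>_def Esub)
    qed
    define U where "U t = 3 powr \<sigma> * \<mu> powr (1 + \<theta>) * spike_sum H t powr \<sigma>" for t
    have U_bound: "norm (\<Sum>k\<in>int_box R. of_real ((norm (fourier_coeff g k))\<^sup>2) * phase (of_int (sq_norm k) * t)) \<le> U t"
      for t
    proof -
      define W where "W = (3 * spike_sum H t) powr (d / 2)"
      have "norm (\<Sum>k\<in>int_box R. of_real ((norm (fourier_coeff g k))\<^sup>2) * phase (of_int (sq_norm k) * t))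
          \<le> W * (LINT x|torus. norm (g x))\<^sup>2"
        unfolding W_def H_def d_def by (intro norm_multiplier_form_le_L1[OF gi] norm_schroedinger_kernel_le)
      also have "\<dots> \<le> W * \<mu>\<^sup>2"
        using g1 by (intro mult_left_mono power_mono) (auto simp: W_def)
      finally have 1: "norm (\<Sum>k\<in>int_box R. of_real ((norm (fourier_coeff g k))\<^sup>2) * phase (of_int (sq_norm k) * t))
          \<le> W * \<mu>\<^sup>2" .
      have "norm (\<Sum>k\<in>int_box R. of_real ((norm (fourier_coeff g k))\<^sup>2) * phase (of_int (sq_norm k) * t))
          \<le> (LINT x|torus. (norm (g x))\<^sup>2)"
        by (intro norm_multiplier_form_le_L2 g g2i int_box_subset finite_int_box) simp
      also note g2
      finally have 2: "norm (\<Sum>k\<in>int_box R. of_real ((norm (fourier_coeff g k))\<^sup>2) * phase (of_int (sq_norm k) * t))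
          \<le> \<mu>" .
      have "norm (\<Sum>k\<in>int_box R. of_real ((norm (fourier_coeff g k))\<^sup>2) * phase (of_int (sq_norm k) * t))
          \<le> W powr \<theta> * \<mu> powr (1 + \<theta>)"
        using 1 2 pos \<theta> by (intro powr_interpolate) (auto simp: W_def \<mu>_def)
      also have "W powr \<theta> = 3 powr \<sigma> * spike_sum H t powr \<sigma>"
        by (simp add: W_def powr_powr powr_mult \<sigma>_def)
      finally show ?thesis by (simp add: U_def mult_ac)
    qed
    have U_int: "(\<integral>\<^sup>+t\<in>{0..1}. ennreal (U t) \<partial>lborel)
        \<le> ennreal (3 powr \<sigma> * \<mu> powr (1 + \<theta>)) * ennreal (C0 * real H powr (2 * \<sigma> - 2))"
    proof -
      have "(\<integral>\<^sup>+t\<in>{0..1}. ennreal (U t) \<partial>lborel)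
          = ennreal (3 powr \<sigma> * \<mu> powr (1 + \<theta>)) * (\<integral>\<^sup>+t\<in>{0..1}. ennreal (spike_sum H t powr \<sigma>) \<partial>lborel)"
        by (subst nn_integral_cmult[symmetric]) (auto simp: U_def ennreal_mult' mult.assoc)
      then show ?thesis
        by (metis mult_left_mono[OF moment[OF H(1)] zero_le])
    qed
    have "ennreal (\<Sum>k\<in>{k \<in> int_box R. sq_norm k \<in> I}. (norm (fourier_coeff g k))\<^sup>2)
        \<le> of_nat (card I) * (\<integral>\<^sup>+t\<in>{0..1}. ennreal (U t) \<partial>lborel)"
    proof (rule sum_restricted_le_nn_integral)
      show "U \<in> borel_measurable borel" unfolding U_def[abs_def] by measurable
    qed (use U_bound in \<open>auto simp: finite_int_box I_def\<close>)
    also have "\<dots> \<le> of_nat (card I) * (ennreal (3 powr \<sigma> * \<mu> powr (1 + \<theta>)) * ennreal (C0 * real H powr (2 * \<sigma> - 2)))"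
      by (intro mult_left_mono U_int) simp
    also have "\<dots> = ennreal (real (card I) * (3 powr \<sigma> * \<mu> powr (1 + \<theta>) * (C0 * real H powr (2 * \<sigma> - 2))))"
      using C0 by (simp add: ennreal_mult' ennreal_of_nat_eq_real_of_nat)
    finally have "(\<Sum>k\<in>{k \<in> int_box R. sq_norm k \<in> I}. (norm (fourier_coeff g k))\<^sup>2)
        \<le> real (card I) * (3 powr \<sigma> * \<mu> powr (1 + \<theta>) * (C0 * real H powr (2 * \<sigma> - 2)))"
      using C0 by (subst (asm) ennreal_le_iff) (auto simp: mult_left_mono)
    also have "\<dots> \<le> ((2 + 1 / c) * (N * \<delta>)) * (3 powr \<sigma> * \<mu> powr (1 + \<theta>) * (C0 * (14 * N) powr (2 * \<sigma> - 2)))"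
      unfolding I_def using card_shell_le[OF N c \<delta>(1)] C0 H \<sigma> N c \<delta>0
      by (intro mult_mono mult_left_mono powr_mono2) auto
    also have "\<dots> = C * \<delta> * (N * N powr (2 * \<sigma> - 2)) * \<mu> powr (1 + \<theta>)"
      using N by (simp add: C_def powr_mult mult_ac)
    also have "N * N powr (2 * \<sigma> - 2) = N powr (d * \<theta> - 1)"
      using N by (simp add: powr_mult_base \<sigma>_def)
    also have "{k \<in> int_box R. sq_norm k \<in> I} = int_lattice \<inter> annulus N \<delta>"
      unfolding I_def using \<delta>0 by (intro annulus_eq_box_shell[symmetric] N \<delta> R) simp
    finally show ?thesis by (simp add: \<mu>_def)
  qed
  with C show ?thesis by (intro that[of C]) (auto simp: d_def)
qed

section \<open>Level sets and norms of the spectral projector\<close>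

text \<open>
  Duality: test \<open>F\<close> against its own sign on the level set \<open>E\<close>. The result is \<open>\<alpha>\<mu>\<close> at least, while
  Cauchy-Schwarz on the Fourier side bounds it by \<open>A\<close> times the root of the energy of the test function in the
  annulus. With \<open>1 - \<theta> = 2/p\<close> this is the weak type form of the desired estimate.
\<close>

lemma level_set_bound:
  fixes \<theta> c :: real
  assumes \<theta>: "0 < \<theta>" "\<theta> \<le> 1" "4 < real CARD('n) * \<theta>" and c: "0 < c"
  obtains C where "0 < C"
    "\<And>N \<delta> A \<alpha> (a :: real ^ 'n \<Rightarrow> complex). \<lbrakk>1 \<le> N; c / N \<le> \<delta>; \<delta> \<le> 1; 0 < \<alpha>;
       (\<Sum>k\<in>int_lattice \<inter> annulus N \<delta>. (norm (a k))\<^sup>2) \<le> A\<^sup>2;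
       0 < measure torus {x \<in> cbox 0 1. \<alpha> < norm (\<Sum>k\<in>int_lattice \<inter> annulus N \<delta>. a k * fourier_char k x)}\<rbrakk>
     \<Longrightarrow> \<alpha>\<^sup>2 * measure torus {x \<in> cbox 0 1. \<alpha> < norm (\<Sum>k\<in>int_lattice \<inter> annulus N \<delta>. a k * fourier_char k x)} powr (1 - \<theta>)
        \<le> C * A\<^sup>2 * \<delta> * N powr (real CARD('n) * \<theta> - 1)"
proof -
  obtain C where C: "0 < C" and energy:
    "\<And>N \<delta> (g :: real ^ 'n \<Rightarrow> complex) E. \<lbrakk>1 \<le> N; c / N \<le> \<delta>; \<delta> \<le> 1; g \<in> borel_measurable torus; E \<in> sets torus;
       0 < measure torus E; \<And>x. norm (g x) \<le> indicator E x\<rbrakk>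
     \<Longrightarrow> (\<Sum>k\<in>int_lattice \<inter> annulus N \<delta>. (norm (fourier_coeff g k))\<^sup>2)
        \<le> C * \<delta> * N powr (real CARD('n) * \<theta> - 1) * measure torus E powr (1 + \<theta>)"
    using restricted_fourier_energy_le[OF \<theta> c] by blast
  show ?thesis
  proof (rule that[OF C])
    fix N \<delta> A \<alpha> :: real and a :: "real ^ 'n \<Rightarrow> complex"
    define S where "S = (int_lattice \<inter> annulus N \<delta> :: (real ^ 'n) set)"
    define F where "F x = (\<Sum>k\<in>S. a k * fourier_char k x)" for x
    define E where "E = {x \<in> cbox 0 1. \<alpha> < norm (F x)}"
    define \<mu> where "\<mu> = measure torus E"
    assume N: "1 \<le> N" and \<delta>: "c / N \<le> \<delta>" "\<delta> \<le> 1" and \<alpha>: "0 < \<alpha>"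
      and A: "(\<Sum>k\<in>int_lattice \<inter> annulus N \<delta>. (norm (a k))\<^sup>2) \<le> A\<^sup>2"
      and "0 < measure torus {x \<in> cbox 0 1. \<alpha> < norm (\<Sum>k\<in>int_lattice \<inter> annulus N \<delta>. a k * fourier_char k x)}"
    then have \<mu>: "0 < \<mu>" by (simp add: \<mu>_def E_def F_def S_def)
    have F [measurable]: "F \<in> borel_measurable torus"
      unfolding F_def[abs_def] by measurable
    have E [measurable]: "E \<in> sets torus"
    proof -
      have "{x \<in> space torus. \<alpha> < norm (F x)} \<in> sets torus" by measurable
      then show ?thesis by (simp add: E_def)
    qed
    define g where "g x = indicator E x *\<^sub>R sgn (F x)" for x
    have g [measurable]: "g \<in> borel_measurable torus"
      unfolding g_def[abs_def] sgn_div_norm by measurable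
    have gE: "norm (g x) \<le> indicator E x" for x
      by (auto simp: g_def norm_sgn indicator_def)
    have Esub: "E \<inter> cbox 0 1 = E" by (auto simp: E_def)
    have iE: "integrable torus (indicator E :: _ \<Rightarrow> real)"
      using E by (intro integrable_real_indicator) (auto simp: torus.emeasure_eq_measure)
    have gi: "integrable torus g"
      by (rule Bochner_Integration.integrable_bound[OF iE]) (use gE in auto)
    have gi': "integrable torus (\<lambda>x. cnj (g x))"
      using gi by simp
    have Fg: "F x * cnj (g x) = of_real (indicator E x * norm (F x))" for x
    proof (cases "F x = 0")
      case False
      have "F x * cnj (F x) = of_real ((norm (F x))\<^sup>2)"
        by (rule complex_norm_square[symmetric])
      then show ?thesis
        using False by (simp add: g_def sgn_div_norm scaleR_conv_of_real power2_eq_square field_simps)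
    qed simp
    have FgI: "integrable torus (\<lambda>x. F x * cnj (g x))"
      unfolding F_def sum_distrib_right mult.assoc
      by (intro Bochner_Integration.integrable_sum integrable_mult_right integrable_fourier_char_mult gi')
    then have FI: "integrable torus (\<lambda>x. indicator E x * norm (F x))"
      unfolding Fg by (simp only: complex_of_real_integrable_eq)
    have "\<alpha> * \<mu> = (LINT x|torus. \<alpha> * indicator E x)"
      by (simp add: \<mu>_def Esub)
    also have "\<dots> \<le> (LINT x|torus. indicator E x * norm (F x))"
    proof (rule integral_mono)
      show "integrable torus (\<lambda>x. \<alpha> * indicator E x)" using iE by simp
      show "\<alpha> * indicator E x \<le> indicator E x * norm (F x)" for x
        by (auto simp: E_def indicator_def)
    qed (fact FI)
    also have "\<dots> \<le> norm (of_real (LINT x|torus. indicator E x * norm (F x)) :: complex)"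
      unfolding norm_of_real by (rule abs_ge_self)
    also have "of_real (LINT x|torus. indicator E x * norm (F x)) = (LINT x|torus. F x * cnj (g x))"
      unfolding Fg by (rule integral_complex_of_real[symmetric])
    also have "\<dots> = (\<Sum>k\<in>S. a k * (LINT x|torus. fourier_char k x * cnj (g x)))"
      unfolding F_def sum_distrib_right mult.assoc
      by (simp only: Bochner_Integration.integral_sum integrable_mult_right integrable_fourier_char_mult gi'
          integral_mult_right_zero)
    also have "\<dots> = (\<Sum>k\<in>S. a k * cnj (fourier_coeff g k))"
      by (simp only: cnj_fourier_coeff)
    also have "norm \<dots> \<le> (\<Sum>k\<in>S. norm (a k) * norm (fourier_coeff g k))"
      by (rule order_trans[OF norm_sum]) (simp add: norm_mult)
    finally have "(\<alpha> * \<mu>)\<^sup>2 \<le> (\<Sum>k\<in>S. norm (a k) * norm (fourier_coeff g k))\<^sup>2"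
      using \<alpha> \<mu> by (intro power_mono) auto
    also have "\<dots> \<le> (\<Sum>k\<in>S. (norm (a k))\<^sup>2) * (\<Sum>k\<in>S. (norm (fourier_coeff g k))\<^sup>2)"
      by (rule Cauchy_Schwarz_ineq_sum)
    also have "\<dots> \<le> A\<^sup>2 * (C * \<delta> * N powr (real CARD('n) * \<theta> - 1) * \<mu> powr (1 + \<theta>))"
    proof (rule mult_mono)
      show "(\<Sum>k\<in>S. (norm (fourier_coeff g k))\<^sup>2) \<le> C * \<delta> * N powr (real CARD('n) * \<theta> - 1) * \<mu> powr (1 + \<theta>)"
        unfolding S_def \<mu>_def using \<mu> by (intro energy N \<delta> g E gE) (simp add: \<mu>_def)
    qed (use A in \<open>auto simp: S_def intro: sum_nonneg\<close>)
    finally have "\<alpha>\<^sup>2 * \<mu>\<^sup>2 \<le> (C * A\<^sup>2 * \<delta> * N powr (real CARD('n) * \<theta> - 1)) * \<mu> powr (1 + \<theta>)"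
      by (simp add: power_mult_distrib mult_ac)
    moreover have "\<mu>\<^sup>2 = \<mu> powr (1 - \<theta>) * \<mu> powr (1 + \<theta>)"
      using \<mu> by (simp flip: powr_add)
    ultimately have "\<alpha>\<^sup>2 * \<mu> powr (1 - \<theta>) * \<mu> powr (1 + \<theta>)
        \<le> (C * A\<^sup>2 * \<delta> * N powr (real CARD('n) * \<theta> - 1)) * \<mu> powr (1 + \<theta>)"
      by (simp add: mult.assoc)
    then have "\<alpha>\<^sup>2 * \<mu> powr (1 - \<theta>) \<le> C * A\<^sup>2 * \<delta> * N powr (real CARD('n) * \<theta> - 1)"
      by (rule mult_right_le_imp_le) (use \<mu> in simp)
    then show "\<alpha>\<^sup>2 * measure torus {x \<in> cbox 0 1. \<alpha> < norm (\<Sum>k\<in>int_lattice \<inter> annulus N \<delta>. a k * fourier_char k x)} powr (1 - \<theta>)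
        \<le> C * A\<^sup>2 * \<delta> * N powr (real CARD('n) * \<theta> - 1)"
      by (simp add: \<mu>_def E_def F_def S_def)
  qed
qed

lemma sup_bound:
  fixes c :: real
  assumes d: "5 \<le> CARD('n)" and c: "0 < c"
  obtains C where "0 < C"
    "\<And>N \<delta> A (a :: real ^ 'n \<Rightarrow> complex). \<lbrakk>1 \<le> N; c / N \<le> \<delta>; \<delta> \<le> 1; 0 < A;
       (\<Sum>k\<in>int_lattice \<inter> annulus N \<delta>. (norm (a k))\<^sup>2) \<le> A\<^sup>2\<rbrakk>
     \<Longrightarrow> AE x in torus. norm (\<Sum>k\<in>int_lattice \<inter> annulus N \<delta>. a k * fourier_char k x)
        \<le> C * A * \<delta> powr (1 / 2) * N powr ((real CARD('n) - 1) / 2)"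
proof -
  have "4 < real CARD('n) * 1" using d by simp
  \<comment> \<open>For \<open>\<theta> = 1\<close> the measure of the level set drops out: heights with a non-null level set are bounded.\<close>
  note level_set_bound[OF zero_less_one order_refl this c]
  then obtain C where C: "0 < C" and level:
    "\<And>N \<delta> A \<alpha> (a :: real ^ 'n \<Rightarrow> complex). \<lbrakk>1 \<le> N; c / N \<le> \<delta>; \<delta> \<le> 1; 0 < \<alpha>;
       (\<Sum>k\<in>int_lattice \<inter> annulus N \<delta>. (norm (a k))\<^sup>2) \<le> A\<^sup>2;
       0 < measure torus {x \<in> cbox 0 1. \<alpha> < norm (\<Sum>k\<in>int_lattice \<inter> annulus N \<delta>. a k * fourier_char k x)}\<rbrakk>
     \<Longrightarrow> \<alpha>\<^sup>2 * measure torus {x \<in> cbox 0 1. \<alpha> < norm (\<Sum>k\<in>int_lattice \<inter> annulus N \<delta>. a k * fourier_char k x)} powr (1 - 1)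
        \<le> C * A\<^sup>2 * \<delta> * N powr (real CARD('n) * 1 - 1)"
    by blast
  \<comment> \<open>The factor \<open>2\<close> makes the contradiction below strict.\<close>
  have C': "0 < sqrt (2 * C)" using C by simp
  show ?thesis
  proof (rule that[OF C'])
    fix N \<delta> A :: real and a :: "real ^ 'n \<Rightarrow> complex"
    assume N: "1 \<le> N" and \<delta>: "c / N \<le> \<delta>" "\<delta> \<le> 1" and A: "0 < A"
      and aA: "(\<Sum>k\<in>int_lattice \<inter> annulus N \<delta>. (norm (a k))\<^sup>2) \<le> A\<^sup>2"
    have \<delta>0: "0 < \<delta>" using \<delta> c N by (intro less_le_trans[OF _ \<delta>(1)]) auto
    define F where "F x = (\<Sum>k\<in>int_lattice \<inter> annulus N \<delta>. a k * fourier_char k x)" for x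
    have [measurable]: "F \<in> borel_measurable torus"
      unfolding F_def[abs_def] by measurable
    define B where "B = sqrt (2 * C) * A * \<delta> powr (1 / 2) * N powr ((real CARD('n) - 1) / 2)"
    have B: "0 < B" using C A \<delta>0 N by (simp add: B_def)
    have B2: "B\<^sup>2 = 2 * (C * A\<^sup>2 * \<delta> * N powr (real CARD('n) - 1))"
    proof -
      have "(N powr ((real CARD('n) - 1) / 2))\<^sup>2 = N powr (real CARD('n) - 1)"
        by (simp add: power2_eq_square flip: powr_add)
      then show ?thesis
        using C \<delta>0 by (simp add: B_def power_mult_distrib powr_half_sqrt)
    qed
    have "measure torus {x \<in> cbox 0 1. B < norm (F x)} = 0"
    proof (rule ccontr)
      assume "measure torus {x \<in> cbox 0 1. B < norm (F x)} \<noteq> 0"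
      then have pos: "0 < measure torus {x \<in> cbox 0 1. B < norm (F x)}"
        by (simp add: zero_less_measure_iff)
      have "B\<^sup>2 \<le> C * A\<^sup>2 * \<delta> * N powr (real CARD('n) - 1)"
        using level[OF N \<delta> B aA] pos by (simp add: F_def)
      moreover have "0 < C * A\<^sup>2 * \<delta> * N powr (real CARD('n) - 1)"
        using C A \<delta>0 N by simp
      ultimately show False using B2 by linarith
    qed
    then have "emeasure torus {x \<in> space torus. \<not> norm (F x) \<le> B} = 0"
      by (simp add: torus.emeasure_eq_measure not_le)
    moreover have "{x \<in> space torus. \<not> norm (F x) \<le> B} \<in> sets torus"
      by measurable
    ultimately have "AE x in torus. norm (F x) \<le> B"
      using AE_iff_measurable[OF _ refl, where P = "\<lambda>x. norm (F x) \<le> B" and M = torus] by simp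
    then show "AE x in torus. norm (\<Sum>k\<in>int_lattice \<inter> annulus N \<delta>. a k * fourier_char k x)
        \<le> sqrt (2 * C) * A * \<delta> powr (1 / 2) * N powr ((real CARD('n) - 1) / 2)"
      by (simp add: F_def B_def)
  qed
qed

text \<open>
  The threshold for \<open>p\<close> is an open condition, so the weak type bound holds for some \<open>p0 < p\<close> too, and
  interpolation with the sup bound gives the strong bound. The weak and sup bounds obey the same scaling in
  \<open>N\<close>, \<open>\<delta>\<close> and \<open>A\<close>, hence the powers come out as they should.
\<close>

lemma strong_type_bound:
  fixes p c :: real
  assumes d: "5 \<le> CARD('n)" and p: "2 * real CARD('n) / (real CARD('n) - 4) < p" and c: "0 < c"
  obtains C where "0 < C"
    "\<And>N \<delta> A (a :: real ^ 'n \<Rightarrow> complex). \<lbrakk>1 \<le> N; c / N \<le> \<delta>; \<delta> \<le> 1; 0 < A;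
       (\<Sum>k\<in>int_lattice \<inter> annulus N \<delta>. (norm (a k))\<^sup>2) \<le> A\<^sup>2\<rbrakk>
     \<Longrightarrow> (\<integral>\<^sup>+x. ennreal (norm (\<Sum>k\<in>int_lattice \<inter> annulus N \<delta>. a k * fourier_char k x) powr p) \<partial>torus)
        \<le> ennreal ((C * N powr ((real CARD('n) - 1) / 2 - real CARD('n) / p) * \<delta> powr (1 / 2) * A) powr p)"
proof -
  define d where "d = real CARD('n)"
  have d5: "5 \<le> d" using d by (simp add: d_def)
  define pc where "pc = 2 * d / (d - 4)"
  have pc: "2 < pc" "pc < p" using d5 p by (auto simp: pc_def d_def field_simps)
  define p0 where "p0 = (pc + p) / 2"
  have p0: "2 < p0" "pc < p0" "p0 < p" using pc by (auto simp: p0_def)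
  define \<theta> where "\<theta> = 1 - 2 / p0"
  have \<theta>01: "0 < \<theta>" "\<theta> \<le> 1" using p0 by (auto simp: \<theta>_def)
  have "4 < d * \<theta>"
  proof -
    have "2 * d < p0 * (d - 4)" using p0(2) d5 by (simp add: pc_def field_simps)
    then show ?thesis using p0(1) by (simp add: \<theta>_def field_simps)
  qed
  then have \<theta>: "4 < real CARD('n) * \<theta>" by (simp add: d_def)
  obtain C0 where C0: "0 < C0" and level:
    "\<And>N \<delta> A \<alpha> (a :: real ^ 'n \<Rightarrow> complex). \<lbrakk>1 \<le> N; c / N \<le> \<delta>; \<delta> \<le> 1; 0 < \<alpha>;
       (\<Sum>k\<in>int_lattice \<inter> annulus N \<delta>. (norm (a k))\<^sup>2) \<le> A\<^sup>2;
       0 < measure torus {x \<in> cbox 0 1. \<alpha> < norm (\<Sum>k\<in>int_lattice \<inter> annulus N \<delta>. a k * fourier_char k x)}\<rbrakk>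
     \<Longrightarrow> \<alpha>\<^sup>2 * measure torus {x \<in> cbox 0 1. \<alpha> < norm (\<Sum>k\<in>int_lattice \<inter> annulus N \<delta>. a k * fourier_char k x)} powr (1 - \<theta>)
        \<le> C0 * A\<^sup>2 * \<delta> * N powr (real CARD('n) * \<theta> - 1)"
    using level_set_bound[OF \<theta>01 \<theta> c] by blast
  obtain C1 where C1: "0 < C1" and sup:
    "\<And>N \<delta> A (a :: real ^ 'n \<Rightarrow> complex). \<lbrakk>1 \<le> N; c / N \<le> \<delta>; \<delta> \<le> 1; 0 < A;
       (\<Sum>k\<in>int_lattice \<inter> annulus N \<delta>. (norm (a k))\<^sup>2) \<le> A\<^sup>2\<rbrakk>
     \<Longrightarrow> AE x in torus. norm (\<Sum>k\<in>int_lattice \<inter> annulus N \<delta>. a k * fourier_char k x)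
        \<le> C1 * A * \<delta> powr (1 / 2) * N powr ((real CARD('n) - 1) / 2)"
    using sup_bound[OF d c] by blast
  define D where "D = 2 powr p0 / (1 - 2 powr (p0 - p)) * C0 powr (p0 / 2) * C1 powr (p - p0)"
  have "2 powr (p0 - p) < 1" using p0 by (simp add: powr_less_one)
  then have D: "0 < D" using C0 C1 by (simp add: D_def)
  show ?thesis
  proof (rule that[of "D powr (1 / p)"])
    show "0 < D powr (1 / p)" using D by simp
    fix N \<delta> A :: real and a :: "real ^ 'n \<Rightarrow> complex"
    assume N: "1 \<le> N" and \<delta>: "c / N \<le> \<delta>" "\<delta> \<le> 1" and A: "0 < A"
      and aA: "(\<Sum>k\<in>int_lattice \<inter> annulus N \<delta>. (norm (a k))\<^sup>2) \<le> A\<^sup>2"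
    have \<delta>0: "0 < \<delta>" using \<delta> c N by (intro less_le_trans[OF _ \<delta>(1)]) auto
    define F where "F x = (\<Sum>k\<in>int_lattice \<inter> annulus N \<delta>. a k * fourier_char k x)" for x
    have F [measurable]: "F \<in> borel_measurable torus"
      unfolding F_def[abs_def] by measurable
    define Q where "Q = C0 * A\<^sup>2 * \<delta> * N powr (d * \<theta> - 1)"
    define B where "B = C1 * A * \<delta> powr (1 / 2) * N powr ((d - 1) / 2)"
    have Q: "0 < Q" and B: "0 < B" using C0 C1 A \<delta>0 N by (auto simp: Q_def B_def)
    have weak: "emeasure torus {x \<in> space torus. \<alpha> < norm (F x)} \<le> ennreal (Q powr (p0 / 2) / \<alpha> powr p0)"
      if \<alpha>: "0 < \<alpha>" for \<alpha>
    proof (cases "measure torus {x \<in> cbox 0 1. \<alpha> < norm (F x)} = 0")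
      case True
      then show ?thesis by (simp add: torus.emeasure_eq_measure)
    next
      case False
      define \<mu> where "\<mu> = measure torus {x \<in> cbox 0 1. \<alpha> < norm (F x)}"
      have \<mu>: "0 < \<mu>" using False by (simp add: \<mu>_def zero_less_measure_iff)
      have "\<alpha>\<^sup>2 * \<mu> powr (1 - \<theta>) \<le> Q"
        using level[OF N \<delta> \<alpha> aA] \<mu> by (simp add: \<mu>_def F_def Q_def d_def)
      then have "(\<alpha>\<^sup>2 * \<mu> powr (1 - \<theta>)) powr (p0 / 2) \<le> Q powr (p0 / 2)"
        using p0 by (intro powr_mono2) auto
      moreover have "(\<alpha>\<^sup>2 * \<mu> powr (1 - \<theta>)) powr (p0 / 2) = \<alpha> powr p0 * \<mu>"
        using \<alpha> \<mu> p0 by (simp add: powr_mult powr_powr \<theta>_def flip: powr_numeral)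
      ultimately have "\<mu> \<le> Q powr (p0 / 2) / \<alpha> powr p0"
        using \<alpha> by (simp add: field_simps)
      then show ?thesis
        by (simp add: torus.emeasure_eq_measure \<mu>_def)
    qed
    have "(\<integral>\<^sup>+x. ennreal (norm (F x) powr p) \<partial>torus)
        \<le> ennreal (2 powr p0 / (1 - 2 powr (p0 - p)) * Q powr (p0 / 2) * B powr (p - p0))"
    proof (rule weak_type_imp_strong_type)
      show "AE x in torus. norm (F x) \<le> B"
        using sup[OF N \<delta> A aA] by (simp add: F_def B_def d_def)
    qed (use p0 B weak in auto)
    also have "2 powr p0 / (1 - 2 powr (p0 - p)) * Q powr (p0 / 2) * B powr (p - p0)
        = (D powr (1 / p) * N powr ((d - 1) / 2 - d / p) * \<delta> powr (1 / 2) * A) powr p"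
    proof -
      have "Q powr (p0 / 2) = C0 powr (p0 / 2) * A powr p0 * \<delta> powr (p0 / 2) * N powr ((d * \<theta> - 1) * (p0 / 2))"
        using A by (simp add: Q_def powr_mult powr_powr flip: powr_numeral)
      moreover have "B powr (p - p0) = C1 powr (p - p0) * A powr (p - p0) * \<delta> powr ((p - p0) / 2)
          * N powr ((d - 1) / 2 * (p - p0))"
        by (simp add: B_def powr_mult powr_powr)
      ultimately have "2 powr p0 / (1 - 2 powr (p0 - p)) * Q powr (p0 / 2) * B powr (p - p0)
          = D * (A powr p0 * A powr (p - p0)) * (\<delta> powr (p0 / 2) * \<delta> powr ((p - p0) / 2))
            * (N powr ((d * \<theta> - 1) * (p0 / 2)) * N powr ((d - 1) / 2 * (p - p0)))"
        by (simp add: D_def mult_ac)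
      also have "A powr p0 * A powr (p - p0) = A powr p"
        by (simp flip: powr_add)
      also have "\<delta> powr (p0 / 2) * \<delta> powr ((p - p0) / 2) = \<delta> powr (p / 2)"
        by (simp add: diff_divide_distrib flip: powr_add)
      also have "N powr ((d * \<theta> - 1) * (p0 / 2)) * N powr ((d - 1) / 2 * (p - p0))
          = N powr (((d - 1) / 2 - d / p) * p)"
      proof -
        have "(d * \<theta> - 1) * (p0 / 2) + (d - 1) / 2 * (p - p0) = ((d - 1) / 2 - d / p) * p"
          using p0 by (simp add: \<theta>_def field_simps)
        then show ?thesis by (simp flip: powr_add)
      qed
      also have "D * A powr p * \<delta> powr (p / 2) * N powr (((d - 1) / 2 - d / p) * p)
          = (D powr (1 / p) * N powr ((d - 1) / 2 - d / p) * \<delta> powr (1 / 2) * A) powr p"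
        using p0 D by (simp add: powr_mult powr_powr mult_ac)
      finally show ?thesis .
    qed
    finally show "(\<integral>\<^sup>+x. ennreal (norm (\<Sum>k\<in>int_lattice \<inter> annulus N \<delta>. a k * fourier_char k x) powr p) \<partial>torus)
        \<le> ennreal ((D powr (1 / p) * N powr ((real CARD('n) - 1) / 2 - real CARD('n) / p) * \<delta> powr (1 / 2) * A) powr p)"
      by (simp add: F_def d_def)
  qed
qed

lemma Lp_space_2:
  fixes f :: "real ^ 'n \<Rightarrow> complex"
  assumes "f \<in> Lp_space torus 2"
  shows "f \<in> borel_measurable torus" "integrable torus (\<lambda>x. (norm (f x))\<^sup>2)"
    "Lp_norm torus 2 f = ennreal (sqrt (LINT x|torus. (norm (f x))\<^sup>2))"
proof -
  show f [measurable]: "f \<in> borel_measurable torus"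
    using assms by (simp add: Lp_space_def)
  define I where "I = (\<integral>\<^sup>+x. ennreal ((norm (f x))\<^sup>2) \<partial>torus)"
  have norm_eq: "Lp_norm torus 2 f = (if I = \<infinity> then \<infinity> else ennreal (enn2real I powr (1 / 2)))"
    by (simp add: Lp_norm_def I_def Let_def)
  have "Lp_norm torus 2 f < \<infinity>" using assms by (simp add: Lp_space_def)
  then have I: "I \<noteq> \<infinity>" unfolding norm_eq by (auto split: if_splits)
  show int: "integrable torus (\<lambda>x. (norm (f x))\<^sup>2)"
    using I by (intro integrableI_bounded) (auto simp: I_def less_top)
  have "enn2real I = (LINT x|torus. (norm (f x))\<^sup>2)"
    unfolding I_def by (subst integral_eq_nn_integral) auto
  then show "Lp_norm torus 2 f = ennreal (sqrt (LINT x|torus. (norm (f x))\<^sup>2))"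
    using I norm_eq by (simp add: powr_half_sqrt)
qed

lemma Lp_norm_zero: "Lp_norm M p (\<lambda>x. 0) = 0"
proof -
  have "esssup M (\<lambda>x. 0 :: ennreal) \<le> 0"
    by (rule esssup_I) auto
  then show ?thesis by (simp add: Lp_norm_def)
qed

theorem theorem1p4:
  fixes p :: ennreal and c :: real
  assumes "CARD('n::finite) \<ge> 5"
    and "p > ennreal (2 * real CARD('n) / (real CARD('n) - 4))"
    and "c > 0"
  shows "\<exists>C::real. C > 0 \<and>
    (\<forall>N \<delta> :: real. \<forall>f \<in> Lp_space (torus :: (real ^ 'n) measure) 2.
       N \<ge> 1 \<longrightarrow> c / N \<le> \<delta> \<longrightarrow> \<delta> \<le> 1 \<longrightarrow>
       Lp_norm torus p (spectral_projector N \<delta> f)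
         \<le> ennreal (C * N powr ((real CARD('n) - 1) / 2 - enn2real (of_nat CARD('n) / p))
                      * \<delta> powr (1 / 2))
           * Lp_norm torus 2 f)"
proof -
  define d where "d = real CARD('n)"
  define r where "r = enn2real (of_nat CARD('n) / p)"
  have "\<exists>C>0. \<forall>N \<delta> A. \<forall>a :: real ^ 'n \<Rightarrow> complex. 1 \<le> N \<longrightarrow> c / N \<le> \<delta> \<longrightarrow> \<delta> \<le> 1 \<longrightarrow> 0 < A \<longrightarrow>
      (\<Sum>k\<in>int_lattice \<inter> annulus N \<delta>. (norm (a k))\<^sup>2) \<le> A\<^sup>2 \<longrightarrow>
      Lp_norm torus p (\<lambda>x. \<Sum>k\<in>int_lattice \<inter> annulus N \<delta>. a k * fourier_char k x)
        \<le> ennreal (C * N powr ((d - 1) / 2 - r) * \<delta> powr (1 / 2) * A)"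
  proof (cases "p = \<infinity>")
    case True
    then have r: "r = 0" by (simp add: r_def)
    obtain C where C: "0 < C" and sup:
      "\<And>N \<delta> A (a :: real ^ 'n \<Rightarrow> complex). \<lbrakk>1 \<le> N; c / N \<le> \<delta>; \<delta> \<le> 1; 0 < A;
         (\<Sum>k\<in>int_lattice \<inter> annulus N \<delta>. (norm (a k))\<^sup>2) \<le> A\<^sup>2\<rbrakk>
       \<Longrightarrow> AE x in torus. norm (\<Sum>k\<in>int_lattice \<inter> annulus N \<delta>. a k * fourier_char k x)
          \<le> C * A * \<delta> powr (1 / 2) * N powr ((real CARD('n) - 1) / 2)"
      using sup_bound[OF assms(1,3)] by blast
    show ?thesis
    proof (intro exI[of _ C] conjI allI impI)
      fix N \<delta> A :: real and a :: "real ^ 'n \<Rightarrow> complex"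
      assume h: "1 \<le> N" "c / N \<le> \<delta>" "\<delta> \<le> 1" "0 < A"
        "(\<Sum>k\<in>int_lattice \<inter> annulus N \<delta>. (norm (a k))\<^sup>2) \<le> A\<^sup>2"
      have "esssup torus (\<lambda>x. ennreal (norm (\<Sum>k\<in>int_lattice \<inter> annulus N \<delta>. a k * fourier_char k x)))
          \<le> ennreal (C * N powr ((d - 1) / 2 - r) * \<delta> powr (1 / 2) * A)"
      proof (rule esssup_I)
        show "AE x in torus. ennreal (norm (\<Sum>k\<in>int_lattice \<inter> annulus N \<delta>. a k * fourier_char k x))
            \<le> ennreal (C * N powr ((d - 1) / 2 - r) * \<delta> powr (1 / 2) * A)"
          using sup[OF h] by eventually_elim (auto simp: r d_def mult_ac intro!: ennreal_leI)
      qed measurable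
      then show "Lp_norm torus p (\<lambda>x. \<Sum>k\<in>int_lattice \<inter> annulus N \<delta>. a k * fourier_char k x)
          \<le> ennreal (C * N powr ((d - 1) / 2 - r) * \<delta> powr (1 / 2) * A)"
        by (simp add: Lp_norm_def True)
    qed (fact C)
  next
    case False
    define q where "q = enn2real p"
    have q: "p = ennreal q" using False by (simp add: q_def less_top)
    have q_gt: "2 * real CARD('n) / (real CARD('n) - 4) < q"
      using assms(1,2) unfolding q by (subst (asm) ennreal_less_iff) auto
    have "0 \<le> 2 * real CARD('n) / (real CARD('n) - 4)" using assms(1) by simp
    then have q0: "0 < q" using q_gt by linarith
    have r: "r = d / q"
      using q0 by (simp add: r_def q d_def ennreal_of_nat_eq_real_of_nat divide_ennreal)
    obtain C where C: "0 < C" and strong: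
      "\<And>N \<delta> A (a :: real ^ 'n \<Rightarrow> complex). \<lbrakk>1 \<le> N; c / N \<le> \<delta>; \<delta> \<le> 1; 0 < A;
         (\<Sum>k\<in>int_lattice \<inter> annulus N \<delta>. (norm (a k))\<^sup>2) \<le> A\<^sup>2\<rbrakk>
       \<Longrightarrow> (\<integral>\<^sup>+x. ennreal (norm (\<Sum>k\<in>int_lattice \<inter> annulus N \<delta>. a k * fourier_char k x) powr q) \<partial>torus)
          \<le> ennreal ((C * N powr ((real CARD('n) - 1) / 2 - real CARD('n) / q) * \<delta> powr (1 / 2) * A) powr q)"
      using strong_type_bound[OF assms(1) q_gt assms(3)] by blast
    show ?thesis
    proof (intro exI[of _ C] conjI allI impI)
      fix N \<delta> A :: real and a :: "real ^ 'n \<Rightarrow> complex"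
      assume h: "1 \<le> N" "c / N \<le> \<delta>" "\<delta> \<le> 1" "0 < A"
        "(\<Sum>k\<in>int_lattice \<inter> annulus N \<delta>. (norm (a k))\<^sup>2) \<le> A\<^sup>2"
      define I where "I = (\<integral>\<^sup>+x. ennreal (norm (\<Sum>k\<in>int_lattice \<inter> annulus N \<delta>. a k * fourier_char k x) powr q) \<partial>torus)"
      define Y where "Y = C * N powr ((d - 1) / 2 - r) * \<delta> powr (1 / 2) * A"
      have Y: "0 \<le> Y" using C h by (simp add: Y_def)
      have le: "I \<le> ennreal (Y powr q)"
        using strong[OF h] by (simp add: I_def Y_def r d_def)
      then have fin: "I \<noteq> \<infinity>" by (auto simp: top_unique)
      have "enn2real I \<le> Y powr q" using le by (simp add: enn2real_leI)
      then have "enn2real I powr (1 / q) \<le> (Y powr q) powr (1 / q)"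
        using q0 by (intro powr_mono2) auto
      also have "\<dots> = Y" using q0 Y by (simp add: powr_powr)
      finally have "Lp_norm torus p (\<lambda>x. \<Sum>k\<in>int_lattice \<inter> annulus N \<delta>. a k * fourier_char k x) \<le> ennreal Y"
        using fin q0 by (simp add: Lp_norm_def q I_def[symmetric] ennreal_leI)
      then show "Lp_norm torus p (\<lambda>x. \<Sum>k\<in>int_lattice \<inter> annulus N \<delta>. a k * fourier_char k x)
          \<le> ennreal (C * N powr ((d - 1) / 2 - r) * \<delta> powr (1 / 2) * A)"
        by (simp add: Y_def)
    qed (fact C)
  qed
  then obtain C where C: "0 < C" and bound:
    "\<And>N \<delta> A (a :: real ^ 'n \<Rightarrow> complex). \<lbrakk>1 \<le> N; c / N \<le> \<delta>; \<delta> \<le> 1; 0 < A;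
      (\<Sum>k\<in>int_lattice \<inter> annulus N \<delta>. (norm (a k))\<^sup>2) \<le> A\<^sup>2\<rbrakk> \<Longrightarrow>
      Lp_norm torus p (\<lambda>x. \<Sum>k\<in>int_lattice \<inter> annulus N \<delta>. a k * fourier_char k x)
        \<le> ennreal (C * N powr ((d - 1) / 2 - r) * \<delta> powr (1 / 2) * A)"
    by blast
  show ?thesis
  proof (intro exI[of _ C] conjI allI ballI impI)
    fix N \<delta> :: real and f :: "real ^ 'n \<Rightarrow> complex"
    assume f: "f \<in> Lp_space torus 2" and N: "1 \<le> N" and \<delta>: "c / N \<le> \<delta>" "\<delta> \<le> 1"
    note f2 = Lp_space_2[OF f]
    define A where "A = sqrt (LINT x|torus. (norm (f x))\<^sup>2)"
    have A0: "0 \<le> A" by (simp add: A_def)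
    have "(\<Sum>k\<in>int_lattice \<inter> annulus N \<delta>. (norm (fourier_coeff f k))\<^sup>2) \<le> (LINT x|torus. (norm (f x))\<^sup>2)"
      using f2 finite_int_lattice_annulus by (intro bessel_inequality) auto
    also have "\<dots> = A\<^sup>2" by (simp add: A_def)
    finally have fA: "(\<Sum>k\<in>int_lattice \<inter> annulus N \<delta>. (norm (fourier_coeff f k))\<^sup>2) \<le> A\<^sup>2" .
    have P: "spectral_projector N \<delta> f = (\<lambda>x. \<Sum>k\<in>int_lattice \<inter> annulus N \<delta>. fourier_coeff f k * fourier_char k x)"
      by (rule ext) (simp add: spectral_projector_def)
    have "Lp_norm torus p (spectral_projector N \<delta> f) \<le> ennreal (C * N powr ((d - 1) / 2 - r) * \<delta> powr (1 / 2) * A)"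
    \<comment> \<open>Zero is excluded above, since the sup bound there needs a positive height.\<close>
    proof (cases "A = 0")
      case False
      then show ?thesis unfolding P using A0 by (intro bound N \<delta> fA) auto
    next
      case True
      have "(\<Sum>k\<in>int_lattice \<inter> annulus N \<delta>. (norm (fourier_coeff f k))\<^sup>2) = 0"
        using fA True by (intro antisym sum_nonneg) auto
      then have "fourier_coeff f k = 0" if "k \<in> int_lattice \<inter> annulus N \<delta>" for k
        using that finite_int_lattice_annulus by (subst (asm) sum_nonneg_eq_0_iff) auto
      then have "spectral_projector N \<delta> f = (\<lambda>x. 0)"
        unfolding P by (intro ext sum.neutral) auto
      then show ?thesis by (simp add: Lp_norm_zero)
    qed
    then show "Lp_norm torus p (spectral_projector N \<delta> f)
        \<le> ennreal (C * N powr ((real CARD('n) - 1) / 2 - enn2real (of_nat CARD('n) / p)) * \<delta> powr (1 / 2))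
           * Lp_norm torus 2 f"
      using C A0 unfolding f2(3) A_def[symmetric] by (simp add: d_def r_def ennreal_mult)
  qed (fact C)
qed

end
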